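(* Let $F$ be a field of characteristic different from two. In dimension $5$ there are, up to isomorphism, exactly nine nilpotent Lie algebras over $F$, and they are pairwise non-isomorphic (with basis $e_1,\ldots,e_5$ where products are given): $L_{5,k}=L_{4,k}\oplus I$ for $k=1,2,3$; $L_{5,4}$: $[e_1,e_2]=e_5$, $[e_3,e_4]=e_5$; $L_{5,5}$: $[e_1,e_2]=e_3$, $[e_1,e_3]=e_5$, $[e_2,e_4]=e_5$; $L_{5,6}$: $[e_1,e_2]=e_3$, $[e_1,e_3]=e_4$, $[e_1,e_4]=e_5$, $[e_2,e_3]=e_5$; $L_{5,7}$: $[e_1,e_2]=e_3$, $[e_1,e_3]=e_4$, $[e_1,e_4]=e_5$; $L_{5,8}$: $[e_1,e_2]=e_4$, $[e_1,e_3]=e_5$; and $L_{5,9}$: $[e_1,e_2]=e_3$, $[e_1,e_3]=e_4$, $[e_2,e_3]=e_5$. Of these, $L_{5,1}$, $L_{5,2}$, $L_{5,4}$ and $L_{5,8}$ are CB-algebras, but the others are not.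
   Context: A Lie algebra $L$ is a CB-algebra if, whenever $x,y\in L$ satisfy $[x,y]=0$, then $[[x,z],y]=0$ for all $z\in L$. $I$ denotes a one-dimensional ideal (a one-dimensional abelian algebra) and $\oplus$ is the algebra direct sum. $L_{3,1}$ is the three-dimensional abelian Lie algebra; $L_{3,2}$ has basis $e_1,e_2,e_3$ and non-zero product $[e_1,e_2]=e_3$; $L_{4,1}=L_{3,1}\oplus I$; $L_{4,2}=L_{3,2}\oplus I$; $L_{4,3}$ has basis $e_1,\ldots,e_4$ and non-zero products $[e_1,e_2]=e_3$, $[e_1,e_3]=e_4$. Only non-zero products of basis elements are listed, with $[e_j,e_i]=-[e_i,e_j]$ understood. *)

theory Defs
  imports "HOL-Analysis.Analysis"
begin

text \<open>
  The addition of the underlying vector space is that of the type \<open>'v\<close>; scalar multiplication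
  and Lie bracket are the components of the record.
\<close>

record ('f, 'v) lie_struct =
  smul :: "'f \<Rightarrow> 'v \<Rightarrow> 'v"
  brack :: "'v \<Rightarrow> 'v \<Rightarrow> 'v"

locale lie_algebra = vector_space "smul L"
  for L :: "('f::field, 'v::ab_group_add) lie_struct" +
  assumes linear_brack_right: "Vector_Spaces.linear (smul L) (smul L) (\<lambda>y. brack L x y)"
    and linear_brack_left: "Vector_Spaces.linear (smul L) (smul L) (\<lambda>x. brack L x y)"
    and brack_self: "brack L x x = 0"
    and jacobi: "brack L x (brack L y z) + brack L y (brack L z x) + brack L z (brack L x y) = 0"
begin

fun lower_central :: "nat \<Rightarrow> 'v set" where
  "lower_central 0 = UNIV"
| "lower_central (Suc n) = span {brack L x y | x y. y \<in> lower_central n}"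

end

locale nilpotent_lie_algebra = lie_algebra +
  assumes nilpotent: "\<exists>n. lower_central n = {0}"

locale cb_algebra = lie_algebra +
  assumes cb: "brack L x y = 0 \<Longrightarrow> brack L (brack L x z) y = 0"

definition lie_dim :: "('f::field, 'v::ab_group_add) lie_struct \<Rightarrow> nat" where
  "lie_dim L = vector_space.dim (smul L) UNIV"

definition lie_iso ::
  "('f::field, 'v::ab_group_add) lie_struct \<Rightarrow> ('f, 'w::ab_group_add) lie_struct \<Rightarrow> bool"
  (infix \<open>\<cong>\<^sub>L\<close> 50) where
  "L \<cong>\<^sub>L M \<longleftrightarrow>
     (\<exists>f. Vector_Spaces.linear (smul L) (smul M) f \<and> bij f \<and>
          (\<forall>x y. f (brack L x y) = brack M (f x) (f y)))"

definition lie_sum ::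
  "('f::field, 'v::ab_group_add) lie_struct \<Rightarrow> ('f, 'w::ab_group_add) lie_struct
     \<Rightarrow> ('f, 'v \<times> 'w) lie_struct"
  (infixl \<open>\<oplus>\<^sub>L\<close> 65) where
  "L \<oplus>\<^sub>L M =
     \<lparr>smul = module_prod.scale (smul L) (smul M),
      brack = (\<lambda>u v. (brack L (fst u) (fst v), brack M (snd u) (snd v)))\<rparr>"

text \<open>
  The algebra with basis \<open>e\<^sub>i = axis i 1\<close> and products \<open>[e\<^sub>i, e\<^sub>j] = e\<^sub>k = - [e\<^sub>j, e\<^sub>i]\<close> for each
  triple \<open>(i, j, k)\<close> of the list, extended bilinearly; all products not covered are zero.
  In an index type such as \<open>5\<close>, the numerals \<open>1, \<dots>, 5\<close> are the five distinct elements, with \<open>5 = 0\<close>.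
\<close>

definition lie_of_products :: "('n::finite \<times> 'n \<times> 'n) list \<Rightarrow> ('f::field, 'f ^ 'n) lie_struct" where
  "lie_of_products ps =
     \<lparr>smul = (*s),
      brack = (\<lambda>x y. \<Sum>(i, j, k)\<leftarrow>ps. (x $ i * y $ j - x $ j * y $ i) *s axis k 1)\<rparr>"

definition lie_I :: "('f::field, 'f) lie_struct" where
  "lie_I = \<lparr>smul = (*), brack = (\<lambda>_ _. 0)\<rparr>"

definition L3_1 :: "('f::field, 'f ^ 3) lie_struct" where
  "L3_1 = lie_of_products []"

definition L3_2 :: "('f::field, 'f ^ 3) lie_struct" where
  "L3_2 = lie_of_products [(1, 2, 3)]"

definition L4_1 :: "('f::field, ('f ^ 3) \<times> 'f) lie_struct" where
  "L4_1 = L3_1 \<oplus>\<^sub>L lie_I"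

definition L4_2 :: "('f::field, ('f ^ 3) \<times> 'f) lie_struct" where
  "L4_2 = L3_2 \<oplus>\<^sub>L lie_I"

definition L4_3 :: "('f::field, 'f ^ 4) lie_struct" where
  "L4_3 = lie_of_products [(1, 2, 3), (1, 3, 4)]"

definition L5_1 :: "('f::field, (('f ^ 3) \<times> 'f) \<times> 'f) lie_struct" where
  "L5_1 = L4_1 \<oplus>\<^sub>L lie_I"

definition L5_2 :: "('f::field, (('f ^ 3) \<times> 'f) \<times> 'f) lie_struct" where
  "L5_2 = L4_2 \<oplus>\<^sub>L lie_I"

definition L5_3 :: "('f::field, ('f ^ 4) \<times> 'f) lie_struct" where
  "L5_3 = L4_3 \<oplus>\<^sub>L lie_I"

definition L5_4 :: "('f::field, 'f ^ 5) lie_struct" where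
  "L5_4 = lie_of_products [(1, 2, 5), (3, 4, 5)]"

definition L5_5 :: "('f::field, 'f ^ 5) lie_struct" where
  "L5_5 = lie_of_products [(1, 2, 3), (1, 3, 5), (2, 4, 5)]"

definition L5_6 :: "('f::field, 'f ^ 5) lie_struct" where
  "L5_6 = lie_of_products [(1, 2, 3), (1, 3, 4), (1, 4, 5), (2, 3, 5)]"

definition L5_7 :: "('f::field, 'f ^ 5) lie_struct" where
  "L5_7 = lie_of_products [(1, 2, 3), (1, 3, 4), (1, 4, 5)]"

definition L5_8 :: "('f::field, 'f ^ 5) lie_struct" where
  "L5_8 = lie_of_products [(1, 2, 4), (1, 3, 5)]"

definition L5_9 :: "('f::field, 'f ^ 5) lie_struct" where
  "L5_9 = lie_of_products [(1, 2, 3), (1, 3, 4), (2, 3, 5)]"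

text \<open>
  The nine algebras live on different types, so the family is indexed through the predicate
  "isomorphic to the \<open>k\<close>-th algebra of the list", which is false unless \<open>1 \<le> k \<le> 9\<close>.
\<close>

definition iso_L5 :: "nat \<Rightarrow> ('f::field, 'v::ab_group_add) lie_struct \<Rightarrow> bool" where
  "iso_L5 k L \<longleftrightarrow>
     k = 1 \<and> L \<cong>\<^sub>L L5_1 \<or> k = 2 \<and> L \<cong>\<^sub>L L5_2 \<or> k = 3 \<and> L \<cong>\<^sub>L L5_3 \<or>
     k = 4 \<and> L \<cong>\<^sub>L L5_4 \<or> k = 5 \<and> L \<cong>\<^sub>L L5_5 \<or> k = 6 \<and> L \<cong>\<^sub>L L5_6 \<or>
     k = 7 \<and> L \<cong>\<^sub>L L5_7 \<or> k = 8 \<and> L \<cong>\<^sub>L L5_8 \<or> k = 9 \<and> L \<cong>\<^sub>L L5_9"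

definition nilpotent_of_dim :: "nat \<Rightarrow> ('f::field, 'v::ab_group_add) lie_struct \<Rightarrow> bool" where
  "nilpotent_of_dim n L \<longleftrightarrow> nilpotent_lie_algebra L \<and> lie_dim L = n"

end

theory Submission
  imports Defs
begin

text \<open>
  Refining the lower central series of a five-dimensional nilpotent Lie algebra to a flag of ideals
  gives a basis in which bracketing with any element moves \<open>v\<^sub>k\<close> into the span of the later basis
  vectors. Such an adapted basis has ten structure constants \<open>a, \<dots>, j\<close>, for which the Jacobi
  identity reads \<open>a j = 0\<close> and \<open>f h - d i + b j = 0\<close>, and each \<open>L\<^bsub>5,k\<^esub>\<close> is the algebra of one
  particular choice of constants. Explicit changes of adapted basis bring the constants into one of
  these nine forms, according to the cases (A) \<open>j \<noteq> 0\<close>, (B) \<open>j = 0\<close> and \<open>(h, i) \<noteq> 0\<close>,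
  (C) \<open>h = i = j = 0\<close> and \<open>a \<noteq> 0\<close>, (D) \<open>h = i = j = a = 0\<close>. The nine algebras are told apart by
  properties expressible through the bracket alone, such as the nilpotency class, the existence of
  two non-commuting elements centralizing the derived algebra, or the existence of such an element
  \<open>x\<close> with \<open>[y, [y, x]] \<noteq> 0\<close> or \<open>[y, [y, [y, x]]] \<noteq> 0\<close>.
\<close>

section \<open>Adapted bases\<close>

context lie_algebra
begin

lemma brack_add_left: "brack L (x + y) z = brack L x z + brack L y z"
  by (rule module_hom.add[OF module_hom_linearI[OF linear_brack_left]])

lemma brack_add_right: "brack L x (y + z) = brack L x y + brack L x z"
  by (rule module_hom.add[OF module_hom_linearI[OF linear_brack_right]])

lemma brack_smul_left: "brack L (smul L r x) z = smul L r (brack L x z)"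
  by (rule module_hom.scale[OF module_hom_linearI[OF linear_brack_left]])

lemma brack_smul_right: "brack L x (smul L r z) = smul L r (brack L x z)"
  by (rule module_hom.scale[OF module_hom_linearI[OF linear_brack_right]])

lemma brack_zero_left: "brack L 0 x = 0"
  using brack_smul_left[of 0 0 x] by simp

lemma brack_zero_right: "brack L x 0 = 0"
  using brack_smul_right[of x 0 0] by simp

lemma brack_swap: "brack L y x = - brack L x y"
proof -
  have "brack L x y + brack L y x = 0"
    using brack_self[of "x + y"] unfolding brack_add_left brack_add_right
    by (simp add: brack_self add.commute)
  then show ?thesis by (simp add: eq_neg_iff_add_eq_0 add.commute)
qed

lemmas brack_simps = brack_add_left brack_add_right brack_smul_left brack_smul_right
  brack_zero_left brack_zero_right brack_self

abbreviation lincomb5 ::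
  "'v \<Rightarrow> 'v \<Rightarrow> 'v \<Rightarrow> 'v \<Rightarrow> 'v \<Rightarrow> 'f \<Rightarrow> 'f \<Rightarrow> 'f \<Rightarrow> 'f \<Rightarrow> 'f \<Rightarrow> 'v" where
  "lincomb5 v1 v2 v3 v4 v5 x1 x2 x3 x4 x5 \<equiv>
     smul L x1 v1 + smul L x2 v2 + smul L x3 v3 + smul L x4 v4 + smul L x5 v5"

text \<open>Independence of a list rather than of a set: repetitions are excluded, and a condition
  on coefficients can be checked by field arithmetic after a change of basis.\<close>

definition indep5 where
  "indep5 v1 v2 v3 v4 v5 \<longleftrightarrow> (\<forall>x1 x2 x3 x4 x5. lincomb5 v1 v2 v3 v4 v5 x1 x2 x3 x4 x5 = 0
     \<longrightarrow> x1 = 0 \<and> x2 = 0 \<and> x3 = 0 \<and> x4 = 0 \<and> x5 = 0)"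

lemma span5: "x \<in> span {v1, v2, v3, v4, v5} \<longleftrightarrow>
    (\<exists>x1 x2 x3 x4 x5. x = lincomb5 v1 v2 v3 v4 v5 x1 x2 x3 x4 x5)"
  unfolding span_breakdown_eq span_empty by (simp add: diff_diff_eq add.assoc)

lemma span4: "x \<in> span {v1, v2, v3, v4} \<longleftrightarrow>
    (\<exists>x1 x2 x3 x4. x = smul L x1 v1 + smul L x2 v2 + smul L x3 v3 + smul L x4 v4)"
  unfolding span_breakdown_eq span_empty by (simp add: diff_diff_eq add.assoc)

lemma span3: "x \<in> span {v1, v2, v3} \<longleftrightarrow> (\<exists>x1 x2 x3. x = smul L x1 v1 + smul L x2 v2 + smul L x3 v3)"
  unfolding span_breakdown_eq span_empty by (simp add: diff_diff_eq add.assoc)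

lemma span2: "x \<in> span {v1, v2} \<longleftrightarrow> (\<exists>x1 x2. x = smul L x1 v1 + smul L x2 v2)"
  unfolding span_breakdown_eq span_empty by (simp add: diff_diff_eq add.assoc)

lemma span1: "x \<in> span {v1} \<longleftrightarrow> (\<exists>x1. x = smul L x1 v1)"
  unfolding span_breakdown_eq span_empty by (simp add: diff_diff_eq add.assoc)

text \<open>A flag built from the bottom delivers the right-hand side. Conversely, the leading
  coefficient of a vanishing combination must be zero, since otherwise its vector would lie in the
  span of the later ones; then the next coefficient is leading.\<close>

lemma indep5_iff_not_in_span:
  "indep5 v1 v2 v3 v4 v5 \<longleftrightarrow> v5 \<notin> span {} \<and> v4 \<notin> span {v5} \<and> v3 \<notin> span {v4, v5}
     \<and> v2 \<notin> span {v3, v4, v5} \<and> v1 \<notin> span {v2, v3, v4, v5}" (is "?L \<longleftrightarrow> ?R")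
proof
  assume ?L
  then have *: "\<And>x1 x2 x3 x4 x5. lincomb5 v1 v2 v3 v4 v5 x1 x2 x3 x4 x5 = 0
     \<Longrightarrow> x1 = 0 \<and> x2 = 0 \<and> x3 = 0 \<and> x4 = 0 \<and> x5 = 0"
    by (auto simp: indep5_def)
  have "v5 \<notin> span {}"
    using *[of 0 0 0 0 1] by auto
  moreover have "v4 \<notin> span {v5}"
  proof
    assume "v4 \<in> span {v5}"
    then obtain x where "v4 = smul L x v5" unfolding span1 by blast
    then show False using *[of 0 0 0 1 "- x"] by simp
  qed
  moreover have "v3 \<notin> span {v4, v5}"
  proof
    assume "v3 \<in> span {v4, v5}"
    then obtain x y where "v3 = smul L x v4 + smul L y v5" unfolding span2 by blast
    then show False using *[of 0 0 1 "- x" "- y"] by simp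
  qed
  moreover have "v2 \<notin> span {v3, v4, v5}"
  proof
    assume "v2 \<in> span {v3, v4, v5}"
    then obtain x y z where "v2 = smul L x v3 + smul L y v4 + smul L z v5" unfolding span3 by blast
    then show False using *[of 0 1 "- x" "- y" "- z"] by simp
  qed
  moreover have "v1 \<notin> span {v2, v3, v4, v5}"
  proof
    assume "v1 \<in> span {v2, v3, v4, v5}"
    then obtain x y z u where
      "v1 = smul L x v2 + smul L y v3 + smul L z v4 + smul L u v5" unfolding span4 by blast
    then show False using *[of 1 "- x" "- y" "- z" "- u"] by simp
  qed
  ultimately show ?R by blast
next
  assume R: ?R
  have drop: "y = 0" if "smul L y v + u = 0" "u \<in> span S" "v \<notin> span S" for y v u S
  proof (rule ccontr)
    assume "y \<noteq> 0"
    then have "v = smul L (inverse y) (smul L y v)" by simp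
    also have "smul L y v = - u" using that(1) by (simp add: eq_neg_iff_add_eq_0)
    finally show False using that(2,3) span_neg span_scale by metis
  qed
  show ?L
    unfolding indep5_def
  proof (intro allI impI)
    fix x1 x2 x3 x4 x5
    assume 0: "lincomb5 v1 v2 v3 v4 v5 x1 x2 x3 x4 x5 = 0"
    have x1: "x1 = 0"
      by (rule drop[of x1 v1 "smul L x2 v2 + (smul L x3 v3 + (smul L x4 v4 + smul L x5 v5))" "{v2, v3, v4, v5}"];
          (intro span_add span_scale span_base)?;
          use 0 R in \<open>simp add: add.assoc\<close>)
    have x2: "x2 = 0"
      by (rule drop[of x2 v2 "(smul L x3 v3 + (smul L x4 v4 + smul L x5 v5))" "{v3, v4, v5}"];
          (intro span_add span_scale span_base)?;
          use 0 R x1 in \<open>simp add: add.assoc\<close>)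
    have x3: "x3 = 0"
      by (rule drop[of x3 v3 "(smul L x4 v4 + smul L x5 v5)" "{v4, v5}"];
          (intro span_add span_scale span_base)?;
          use 0 R x1 x2 in \<open>simp add: add.assoc\<close>)
    have x4: "x4 = 0"
      by (rule drop[of x4 v4 "smul L x5 v5" "{v5}"];
          (intro span_add span_scale span_base)?;
          use 0 R x1 x2 x3 in \<open>simp add: add.assoc\<close>)
    show "x1 = 0 \<and> x2 = 0 \<and> x3 = 0 \<and> x4 = 0 \<and> x5 = 0"
      using 0 R x1 x2 x3 x4 by auto
  qed
qed

lemma indep5_independent:
  assumes "indep5 v1 v2 v3 v4 v5"
  shows "independent {v1, v2, v3, v4, v5}" "card {v1, v2, v3, v4, v5} = 5"
proof -
  have n: "v5 \<noteq> 0" "v4 \<notin> span {v5}" "v3 \<notin> span {v4, v5}"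
     "v2 \<notin> span {v3, v4, v5}" "v1 \<notin> span {v2, v3, v4, v5}"
    using assms by (auto simp: indep5_iff_not_in_span)
  then show "independent {v1, v2, v3, v4, v5}"
    by (intro independent_insertI independent_empty) simp_all
  have *: "v \<notin> S" if "v \<notin> span S" for v S
    using that span_base by blast
  show "card {v1, v2, v3, v4, v5} = 5"
    using *[OF n(2)] *[OF n(3)] *[OF n(4)] *[OF n(5)] by simp
qed

lemma dim_eq_5I:
  assumes "indep5 v1 v2 v3 v4 v5" "span {v1, v2, v3, v4, v5} = UNIV"
  shows "dim UNIV = 5"
proof -
  have "span {v1, v2, v3, v4, v5} = span UNIV" unfolding assms(2) span_UNIV ..
  from dim_eq_card[OF this indep5_independent(1)[OF assms(1)]]
  show ?thesis unfolding indep5_independent(2)[OF assms(1)] .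
qed

text \<open>\<open>card\<close> is 0 on infinite sets, so a positive dimension forces the basis to
  be finite.\<close>

lemma finite_basis_of_dim:
  assumes "dim UNIV = n" "n > 0"
  obtains B where "independent B" "span B = UNIV" "finite B" "card B = n"
proof -
  obtain B where B: "independent B" "UNIV \<subseteq> span B" "card B = dim UNIV"
    using basis_exists[of UNIV] by metis
  show thesis
  proof (rule that[of B])
    show "finite B" using B(3) assms card_ge_0_finite by metis
    show "span B = UNIV" using B(2) by (rule top.extremum_uniqueI)
  qed (simp_all add: B assms)
qed

text \<open>A vector outside the span would extend the five to six independent vectors in a space
  spanned by five.\<close>

lemma indep5_spanning:
  assumes "dim UNIV = 5" "indep5 v1 v2 v3 v4 v5"
  shows "span {v1, v2, v3, v4, v5} = UNIV"
proof -
  obtain B where B: "independent B" "span B = UNIV" "finite B" "card B = 5"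
    using finite_basis_of_dim assms(1) by (metis zero_less_numeral)
  let ?S = "{v1, v2, v3, v4, v5}"
  have "x \<in> span ?S" for x
  proof (rule ccontr)
    assume x: "x \<notin> span ?S"
    then have "independent (insert x ?S)"
      using indep5_independent(1)[OF assms(2)] by (rule independent_insertI)
    then have "card (insert x ?S) \<le> card B"
      using independent_span_bound[OF B(3), of "insert x ?S"] B(2) by simp
    moreover have "card (insert x ?S) = 6"
    proof -
      from span_base[of x ?S] x have "x \<notin> ?S" by metis
      then have "card (insert x ?S) = Suc (card ?S)" by (intro card_insert_disjoint) simp_all
      then show ?thesis unfolding indep5_independent(2)[OF assms(2)] by simp
    qed
    ultimately show False using B(4) by simp
  qed
  then show ?thesis by blast
qed

lemma span_neq_UNIV:
  assumes "dim UNIV = n" "finite S" "card S < n"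
  shows "span S \<noteq> UNIV"
proof
  assume "span S = UNIV"
  then have "dim UNIV \<le> card S"
    using assms(2) by (intro dim_le_card) simp_all
  then show False using assms(1,3) by linarith
qed

end

section \<open>Structure constants and coordinates\<close>

locale adapted_basis = lie_algebra L
  for L :: "('f::field, 'v::ab_group_add) lie_struct" +
  fixes v1 v2 v3 v4 v5 :: 'v and a b c d e f g h i j :: 'f
  assumes indep: "lincomb5 v1 v2 v3 v4 v5 x1 x2 x3 x4 x5 = 0 \<Longrightarrow>
      x1 = 0 \<and> x2 = 0 \<and> x3 = 0 \<and> x4 = 0 \<and> x5 = 0"
    and spanning: "\<exists>x1 x2 x3 x4 x5. x = lincomb5 v1 v2 v3 v4 v5 x1 x2 x3 x4 x5"
    and brack_basis:
      "brack L v1 v2 = smul L a v3 + smul L b v4 + smul L c v5"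
      "brack L v1 v3 = smul L d v4 + smul L e v5"
      "brack L v2 v3 = smul L f v4 + smul L g v5"
      "brack L v1 v4 = smul L h v5"
      "brack L v2 v4 = smul L i v5"
      "brack L v3 v4 = smul L j v5"
      "brack L v1 v5 = 0" "brack L v2 v5 = 0" "brack L v3 v5 = 0" "brack L v4 v5 = 0"

text \<open>Spanning follows from the dimension by \<open>indep5_spanning\<close>, so only
  independence and the brackets remain to be checked.\<close>

lemma (in lie_algebra) adapted_basisI:
  assumes "dim UNIV = 5" "indep5 v1 v2 v3 v4 v5"
    and "brack L v1 v2 = smul L a v3 + smul L b v4 + smul L c v5"
      "brack L v1 v3 = smul L d v4 + smul L e v5"
      "brack L v2 v3 = smul L f v4 + smul L g v5"
      "brack L v1 v4 = smul L h v5"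
      "brack L v2 v4 = smul L i v5"
      "brack L v3 v4 = smul L j v5"
      "brack L v1 v5 = 0" "brack L v2 v5 = 0" "brack L v3 v5 = 0" "brack L v4 v5 = 0"
  shows "adapted_basis L v1 v2 v3 v4 v5 a b c d e f g h i j"
proof
  show "\<exists>x1 x2 x3 x4 x5. x = lincomb5 v1 v2 v3 v4 v5 x1 x2 x3 x4 x5" for x
    using indep5_spanning[OF assms(1,2)] span5[of x v1 v2 v3 v4 v5] by (metis UNIV_I)
qed (use assms in \<open>simp_all add: indep5_def\<close>)

context adapted_basis
begin

text \<open>Coordinates get a constant of their own so that sums, multiples and brackets are
  computed on coefficients and equations between vectors split into equations in the field.\<close>

definition comb where
  "comb x1 x2 x3 x4 x5 = lincomb5 v1 v2 v3 v4 v5 x1 x2 x3 x4 x5"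

lemma comb_add: "comb x1 x2 x3 x4 x5 + comb y1 y2 y3 y4 y5
    = comb (x1 + y1) (x2 + y2) (x3 + y3) (x4 + y4) (x5 + y5)"
  by (simp add: comb_def scale_left_distrib)

lemma smul_comb: "smul L r (comb x1 x2 x3 x4 x5) = comb (r * x1) (r * x2) (r * x3) (r * x4) (r * x5)"
  by (simp add: comb_def scale_right_distrib)

lemma comb_eq_0_iff: "comb x1 x2 x3 x4 x5 = 0 \<longleftrightarrow> x1 = 0 \<and> x2 = 0 \<and> x3 = 0 \<and> x4 = 0 \<and> x5 = 0"
  using indep by (auto simp: comb_def)

lemma comb_minus: "comb x1 x2 x3 x4 x5 - comb y1 y2 y3 y4 y5
    = comb (x1 - y1) (x2 - y2) (x3 - y3) (x4 - y4) (x5 - y5)"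
  by (simp add: comb_def scale_left_diff_distrib)

lemma comb_eq_iff: "comb x1 x2 x3 x4 x5 = comb y1 y2 y3 y4 y5
    \<longleftrightarrow> x1 = y1 \<and> x2 = y2 \<and> x3 = y3 \<and> x4 = y4 \<and> x5 = y5"
  using comb_eq_0_iff[of "x1 - y1" "x2 - y2" "x3 - y3" "x4 - y4" "x5 - y5"]
  by (simp flip: comb_minus)

lemma ex_comb: "\<exists>x1 x2 x3 x4 x5. x = comb x1 x2 x3 x4 x5"
  using spanning by (simp add: comb_def)

text \<open>Here and in \<open>ex_comb_iff\<close> quantifiers move from vectors to scalars, where
  \<open>brack_comb\<close> and \<open>comb_eq_0_iff\<close> leave polynomial conditions.\<close>

lemma all_comb: "(\<forall>x. P x) \<longleftrightarrow> (\<forall>x1 x2 x3 x4 x5. P (comb x1 x2 x3 x4 x5))"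
  by (metis ex_comb)

lemma ex_comb_iff: "(\<exists>x. P x) \<longleftrightarrow> (\<exists>x1 x2 x3 x4 x5. P (comb x1 x2 x3 x4 x5))"
  by (metis ex_comb)

lemma brack_basis_swap:
  "brack L v2 v1 = - (smul L a v3 + smul L b v4 + smul L c v5)"
  "brack L v3 v1 = - (smul L d v4 + smul L e v5)"
  "brack L v3 v2 = - (smul L f v4 + smul L g v5)"
  "brack L v4 v1 = - smul L h v5"
  "brack L v4 v2 = - smul L i v5"
  "brack L v4 v3 = - smul L j v5"
  "brack L v5 v1 = 0" "brack L v5 v2 = 0" "brack L v5 v3 = 0" "brack L v5 v4 = 0"
  using brack_basis brack_swap[of v2 v1] brack_swap[of v3 v1] brack_swap[of v3 v2] brack_swap[of v4 v1]
    brack_swap[of v4 v2] brack_swap[of v4 v3] brack_swap[of v5 v1] brack_swap[of v5 v2]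
    brack_swap[of v5 v3] brack_swap[of v5 v4]
  by simp_all

text \<open>By bilinearity and antisymmetry the product depends only on the 2 by 2 minors of the two
  coordinate vectors, weighted by the structure constants.\<close>

lemma brack_comb:
  "brack L (comb x1 x2 x3 x4 x5) (comb y1 y2 y3 y4 y5) =
     comb 0 0 (a * (x1 * y2 - x2 * y1))
       (b * (x1 * y2 - x2 * y1) + d * (x1 * y3 - x3 * y1) + f * (x2 * y3 - x3 * y2))
       (c * (x1 * y2 - x2 * y1) + e * (x1 * y3 - x3 * y1) + g * (x2 * y3 - x3 * y2)
        + h * (x1 * y4 - x4 * y1) + i * (x2 * y4 - x4 * y2) + j * (x3 * y4 - x4 * y3))"
  by (simp add: comb_def brack_simps brack_basis brack_basis_swap algebra_simps)

end

section \<open>Existence of an adapted basis\<close>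

context nilpotent_lie_algebra
begin

text \<open>Take the first term of the lower central series contained in the ideal
  \<open>span S\<close>. The term before it contains some \<open>v\<close> outside the ideal, and
  bracketing sends \<open>v\<close> into the ideal.\<close>

lemma ideal_extend:
  assumes "\<And>x y. y \<in> span S \<Longrightarrow> brack L x y \<in> span S" "span S \<noteq> UNIV"
  obtains v where "v \<notin> span S" "\<And>x. brack L x v \<in> span S"
    "\<And>x y. y \<in> span (insert v S) \<Longrightarrow> brack L x y \<in> span (insert v S)"
proof -
  define n where "n = (LEAST n. lower_central n \<subseteq> span S)"
  obtain m where "lower_central m = {0}" using nilpotent by blast
  then have ex: "\<exists>n. lower_central n \<subseteq> span S" by (intro exI[of _ m]) (simp add: span_zero)
  have n: "lower_central n \<subseteq> span S" unfolding n_def by (rule LeastI_ex[OF ex])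
  \<comment> \<open>\<open>n = 0\<close> would put \<open>UNIV\<close> inside
    \<open>span S\<close>.\<close>
  then obtain k where k: "n = Suc k" using assms(2) by (cases n) auto
  have "\<not> lower_central k \<subseteq> span S"
    using not_less_Least[of k "\<lambda>n. lower_central n \<subseteq> span S"] k n_def by simp
  then obtain v where v: "v \<in> lower_central k" "v \<notin> span S" by blast
  have b: "brack L x v \<in> span S" for x
  proof -
    have "brack L x v \<in> lower_central n" unfolding k lower_central.simps
      using v by (intro span_base) blast
    then show ?thesis using n by blast
  qed
  have "brack L x y \<in> span (insert v S)" if y: "y \<in> span (insert v S)" for x y
  proof -
    obtain r where r: "y - smul L r v \<in> span S" using y unfolding span_breakdown_eq by blast
    \<comment> \<open>The first summand lies in \<open>span S\<close> because that is an ideal, the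
      second by the choice of \<open>v\<close>.\<close>
    have "brack L x y = brack L x (y - smul L r v) + smul L r (brack L x v)"
      by (simp flip: brack_smul_right brack_add_right)
    then have "brack L x y \<in> span S"
      using span_add[OF assms(1)[OF r, of x] span_scale[OF b[of x], of r]] by simp
    then show ?thesis using span_mono[OF subset_insertI] by blast
  qed
  with v(2) b show thesis by (rule that)
qed

text \<open>Four uses of \<open>ideal_extend\<close>, starting from the zero ideal, produce
  \<open>v5\<close>, \<open>v4\<close>, \<open>v3\<close> and \<open>v2\<close>; the structure
  constants are the coordinates of the brackets in the ideals below.\<close>

lemma ex_adapted_basis:
  assumes dim: "dim UNIV = 5"
  shows "\<exists>v1 v2 v3 v4 v5 a b c d e f g h i j. adapted_basis L v1 v2 v3 v4 v5 a b c d e f g h i j"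
proof -
  have sub: "span S \<noteq> UNIV" if "finite S" "card S < 5" for S
    using dim that by (rule span_neq_UNIV)
  obtain v5 where v5: "v5 \<notin> span {}" and v5': "\<And>x. brack L x v5 \<in> span {}"
    and i5: "\<And>x y. y \<in> span {v5} \<Longrightarrow> brack L x y \<in> span {v5}"
    by (rule ideal_extend[of "{}"]) (use sub[of "{}"] in \<open>simp_all add: brack_simps\<close>)
  obtain v4 where v4: "v4 \<notin> span {v5}" and v4': "\<And>x. brack L x v4 \<in> span {v5}"
    and i4: "\<And>x y. y \<in> span {v4, v5} \<Longrightarrow> brack L x y \<in> span {v4, v5}"
    using i5 by (rule ideal_extend) (use sub[of "{v5}"] in simp_all)
  obtain v3 where v3: "v3 \<notin> span {v4, v5}" and v3': "\<And>x. brack L x v3 \<in> span {v4, v5}"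
    and i3: "\<And>x y. y \<in> span {v3, v4, v5} \<Longrightarrow> brack L x y \<in> span {v3, v4, v5}"
    using i4 by (rule ideal_extend) (use sub[of "{v4, v5}"] in \<open>simp_all add: card_insert_if\<close>)
  obtain v2 where v2: "v2 \<notin> span {v3, v4, v5}"
    and v2': "\<And>x. brack L x v2 \<in> span {v3, v4, v5}"
    using i3 by (rule ideal_extend) (use sub[of "{v3, v4, v5}"] in \<open>simp_all add: card_insert_if\<close>)
  \<comment> \<open>Any vector outside serves as \<open>v1\<close>: in each prescribed bracket the
    second argument is one of the later vectors, and those are already controlled.\<close>
  have "span {v2, v3, v4, v5} \<noteq> UNIV" by (rule sub) (simp_all add: card_insert_if)
  then obtain v1 where v1: "v1 \<notin> span {v2, v3, v4, v5}" by blast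
  have ind: "indep5 v1 v2 v3 v4 v5"
    unfolding indep5_iff_not_in_span using v1 v2 v3 v4 v5 by blast
  obtain a b c where p1: "brack L v1 v2 = smul L a v3 + smul L b v4 + smul L c v5"
    using v2'[of v1] unfolding span3 by blast
  obtain d e where p2: "brack L v1 v3 = smul L d v4 + smul L e v5"
    using v3'[of v1] unfolding span2 by blast
  obtain f g where p3: "brack L v2 v3 = smul L f v4 + smul L g v5"
    using v3'[of v2] unfolding span2 by blast
  obtain h where p4: "brack L v1 v4 = smul L h v5"
    using v4'[of v1] unfolding span1 by blast
  obtain i where p5: "brack L v2 v4 = smul L i v5"
    using v4'[of v2] unfolding span1 by blast
  obtain j where p6: "brack L v3 v4 = smul L j v5"
    using v4'[of v3] unfolding span1 by blast
  have p7: "brack L x v5 = 0" for x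
    using v5'[of x] by simp
  show ?thesis
    by (intro exI) (rule adapted_basisI[OF dim ind p1 p2 p3 p4 p5 p6 p7 p7 p7 p7])
qed

end

section \<open>Isomorphism in terms of structure constants\<close>

definition adapted ::
  "('f::field, 'v::ab_group_add) lie_struct
    \<Rightarrow> 'f \<Rightarrow> 'f \<Rightarrow> 'f \<Rightarrow> 'f \<Rightarrow> 'f \<Rightarrow> 'f \<Rightarrow> 'f \<Rightarrow> 'f \<Rightarrow> 'f \<Rightarrow> 'f \<Rightarrow> bool" where
  "adapted L a b c d e f g h i j \<longleftrightarrow>
     (\<exists>v1 v2 v3 v4 v5. adapted_basis L v1 v2 v3 v4 v5 a b c d e f g h i j)"

lemma adaptedI: "adapted_basis L v1 v2 v3 v4 v5 a b c d e f g h i j \<Longrightarrow> adapted L a b c d e f g h i j"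
  unfolding adapted_def by blast

lemma adaptedE:
  assumes "adapted L a b c d e f g h i j"
  obtains v1 v2 v3 v4 v5 where "adapted_basis L v1 v2 v3 v4 v5 a b c d e f g h i j"
  using assms unfolding adapted_def by blast

text \<open>Matching coordinates is a linear bijection, and it respects brackets because
  \<open>brack_comb\<close> involves nothing but the shared constants.\<close>

lemma adapted_basis_imp_lie_iso:
  assumes "adapted_basis L v1 v2 v3 v4 v5 a b c d e f g h i j"
    and "adapted_basis M w1 w2 w3 w4 w5 a b c d e f g h i j"
  shows "L \<cong>\<^sub>L M"
proof -
  interpret A: adapted_basis L v1 v2 v3 v4 v5 a b c d e f g h i j by fact
  interpret B: adapted_basis M w1 w2 w3 w4 w5 a b c d e f g h i j by fact
  \<comment> \<open>The description is unique since coordinates are, by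
    \<open>comb_eq_iff\<close>.\<close>
  define \<phi> where "\<phi> x = (THE y. \<exists>x1 x2 x3 x4 x5. x = A.comb x1 x2 x3 x4 x5 \<and> y = B.comb x1 x2 x3 x4 x5)" for x
  have \<phi>: "\<phi> (A.comb x1 x2 x3 x4 x5) = B.comb x1 x2 x3 x4 x5" for x1 x2 x3 x4 x5
    unfolding \<phi>_def by (rule the_equality) (auto simp: A.comb_eq_iff)
  have "\<phi> (x + y) = \<phi> x + \<phi> y" for x y
  proof -
    obtain x1 x2 x3 x4 x5 where x: "x = A.comb x1 x2 x3 x4 x5" using A.ex_comb by blast
    obtain y1 y2 y3 y4 y5 where y: "y = A.comb y1 y2 y3 y4 y5" using A.ex_comb by blast
    show ?thesis by (simp add: x y \<phi> A.comb_add B.comb_add)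
  qed
  moreover have "\<phi> (smul L r x) = smul M r (\<phi> x)" for r x
  proof -
    obtain x1 x2 x3 x4 x5 where x: "x = A.comb x1 x2 x3 x4 x5" using A.ex_comb by blast
    show ?thesis by (simp add: x \<phi> A.smul_comb B.smul_comb)
  qed
  ultimately have "Vector_Spaces.linear (smul L) (smul M) \<phi>"
    unfolding Vector_Spaces.linear_iff
    by (simp add: A.vector_space_axioms B.vector_space_axioms)
  moreover have "bij \<phi>"
  proof (rule bijI)
    show "inj \<phi>"
    proof (rule injI)
      fix x y assume eq: "\<phi> x = \<phi> y"
      obtain x1 x2 x3 x4 x5 where x: "x = A.comb x1 x2 x3 x4 x5" using A.ex_comb by blast
      obtain y1 y2 y3 y4 y5 where y: "y = A.comb y1 y2 y3 y4 y5" using A.ex_comb by blast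
      show "x = y" using eq by (simp add: x y \<phi> A.comb_eq_iff B.comb_eq_iff)
    qed
    show "surj \<phi>"
    proof (rule surjI)
      fix y
      show "\<phi> (SOME x. \<phi> x = y) = y"
        by (rule someI_ex) (metis B.ex_comb \<phi>)
    qed
  qed
  moreover have "\<phi> (brack L x y) = brack M (\<phi> x) (\<phi> y)" for x y
  proof -
    obtain x1 x2 x3 x4 x5 where x: "x = A.comb x1 x2 x3 x4 x5" using A.ex_comb by blast
    obtain y1 y2 y3 y4 y5 where y: "y = A.comb y1 y2 y3 y4 y5" using A.ex_comb by blast
    show ?thesis by (simp add: x y \<phi> A.brack_comb B.brack_comb)
  qed
  ultimately show ?thesis unfolding lie_iso_def by blast
qed

text \<open>The basis of \<open>M\<close> is pulled back along the inverse of the isomorphism; each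
  bracket relation may be checked after applying the injective map \<open>\<phi>\<close>.\<close>

lemma adapted_lie_iso:
  assumes "lie_algebra L" "L \<cong>\<^sub>L M" "adapted M a b c d e f g h i j"
  shows "adapted L a b c d e f g h i j"
proof -
  interpret L: lie_algebra L by fact
  obtain w1 w2 w3 w4 w5 where "adapted_basis M w1 w2 w3 w4 w5 a b c d e f g h i j"
    using assms(3) by (rule adaptedE)
  then interpret M: adapted_basis M w1 w2 w3 w4 w5 a b c d e f g h i j .
  obtain \<phi> where lin: "Vector_Spaces.linear (smul L) (smul M) \<phi>" and bij: "bij \<phi>"
    and br: "\<And>x y. \<phi> (brack L x y) = brack M (\<phi> x) (\<phi> y)"
    using assms(2) unfolding lie_iso_def by blast
  have add: "\<phi> (x + y) = \<phi> x + \<phi> y" and scale: "\<phi> (smul L r x) = smul M r (\<phi> x)" for x y r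
    using lin unfolding Vector_Spaces.linear_iff by simp_all
  have zero: "\<phi> 0 = 0" using scale[of 0 0] by simp
  have inj: "\<phi> x = \<phi> y \<Longrightarrow> x = y" for x y using bij by (simp add: bij_def inj_eq)
  define \<psi> where "\<psi> = inv \<phi>"
  have inv: "\<phi> (\<psi> x) = x" for x
    unfolding \<psi>_def using bij by (simp add: bij_def surj_f_inv_f)
  have "adapted_basis L (\<psi> w1) (\<psi> w2) (\<psi> w3) (\<psi> w4) (\<psi> w5) a b c d e f g h i j"
  proof
    fix x1 x2 x3 x4 x5
    assume "smul L x1 (\<psi> w1) + smul L x2 (\<psi> w2) + smul L x3 (\<psi> w3) + smul L x4 (\<psi> w4)
      + smul L x5 (\<psi> w5) = 0"
    then have "\<phi> (smul L x1 (\<psi> w1) + smul L x2 (\<psi> w2) + smul L x3 (\<psi> w3) + smul L x4 (\<psi> w4)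
      + smul L x5 (\<psi> w5)) = \<phi> 0" by simp
    then show "x1 = 0 \<and> x2 = 0 \<and> x3 = 0 \<and> x4 = 0 \<and> x5 = 0"
      unfolding add scale inv zero by (rule M.indep)
  next
    fix x
    obtain x1 x2 x3 x4 x5
      where x: "\<phi> x = smul M x1 w1 + smul M x2 w2 + smul M x3 w3 + smul M x4 w4 + smul M x5 w5"
      using M.spanning by blast
    have "x = smul L x1 (\<psi> w1) + smul L x2 (\<psi> w2) + smul L x3 (\<psi> w3) + smul L x4 (\<psi> w4)
      + smul L x5 (\<psi> w5)"
      by (rule inj) (simp only: x add scale inv)
    then show "\<exists>x1 x2 x3 x4 x5. x = smul L x1 (\<psi> w1) + smul L x2 (\<psi> w2) + smul L x3 (\<psi> w3)
        + smul L x4 (\<psi> w4) + smul L x5 (\<psi> w5)"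
      by (intro exI)
  qed (rule inj, simp only: add scale inv zero br M.brack_basis)+
  then show ?thesis by (rule adaptedI)
qed

section \<open>Dimension and nilpotency read off an adapted basis\<close>

context adapted_basis
begin

lemma dim_UNIV: "dim UNIV = 5"
proof (rule dim_eq_5I)
  show "indep5 v1 v2 v3 v4 v5" unfolding indep5_def using indep by blast
  have "x \<in> span {v1, v2, v3, v4, v5}" for x unfolding span5 by (rule spanning)
  then show "span {v1, v2, v3, v4, v5} = UNIV" by blast
qed

lemma lower_central_Suc_subset:
  assumes "subspace S" "\<And>x y. y \<in> lower_central n \<Longrightarrow> brack L x y \<in> S"
  shows "lower_central (Suc n) \<subseteq> S"
  unfolding lower_central.simps using assms(2) by (intro span_minimal[OF _ assms(1)]) blast

text \<open>A bracket has no component along \<open>v1\<close> or \<open>v2\<close>, so the derived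
  algebra already lies in the span of the last three vectors; each further bracketing loses one
  more, and the fourth term is zero.\<close>

lemma nilpotent_of_dim_5: "nilpotent_of_dim 5 L"
proof -
  have l1: "lower_central (Suc 0) \<subseteq> span {v3, v4, v5}"
  proof (rule lower_central_Suc_subset)
    fix x y
    obtain x1 x2 x3 x4 x5 where x: "x = comb x1 x2 x3 x4 x5" using ex_comb by blast
    obtain y1 y2 y3 y4 y5 where y: "y = comb y1 y2 y3 y4 y5" using ex_comb by blast
    show "brack L x y \<in> span {v3, v4, v5}"
      unfolding x y brack_comb span3 by (intro exI) (simp add: comb_def del: scale_cancel_right)
  qed (rule subspace_span)
  have l2: "lower_central (Suc (Suc 0)) \<subseteq> span {v4, v5}"
  proof (rule lower_central_Suc_subset[OF subspace_span])
    fix x y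
    assume "y \<in> lower_central (Suc 0)"
    then have "y \<in> span {v3, v4, v5}" using l1 by blast
    then obtain y3 y4 y5 where y: "y = comb 0 0 y3 y4 y5"
      unfolding span3 by (auto simp: comb_def)
    obtain x1 x2 x3 x4 x5 where x: "x = comb x1 x2 x3 x4 x5" using ex_comb by blast
    show "brack L x y \<in> span {v4, v5}"
      unfolding x y brack_comb span2 by (intro exI) (simp add: comb_def del: scale_cancel_right)
  qed
  have l3: "lower_central (Suc (Suc (Suc 0))) \<subseteq> span {v5}"
  proof (rule lower_central_Suc_subset[OF subspace_span])
    fix x y
    assume "y \<in> lower_central (Suc (Suc 0))"
    then have "y \<in> span {v4, v5}" using l2 by blast
    then obtain y4 y5 where y: "y = comb 0 0 0 y4 y5"
      unfolding span2 by (auto simp: comb_def)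
    obtain x1 x2 x3 x4 x5 where x: "x = comb x1 x2 x3 x4 x5" using ex_comb by blast
    show "brack L x y \<in> span {v5}"
      unfolding x y brack_comb span1 by (intro exI) (simp add: comb_def del: scale_cancel_right)
  qed
  have "lower_central (Suc (Suc (Suc (Suc 0)))) \<subseteq> span {}"
  proof (rule lower_central_Suc_subset[OF subspace_span])
    fix x y
    assume "y \<in> lower_central (Suc (Suc (Suc 0)))"
    then have "y \<in> span {v5}" using l3 by blast
    then obtain y5 where y: "y = comb 0 0 0 0 y5"
      unfolding span1 by (auto simp: comb_def)
    obtain x1 x2 x3 x4 x5 where x: "x = comb x1 x2 x3 x4 x5" using ex_comb by blast
    show "brack L x y \<in> span {}"
      unfolding x y brack_comb by (simp add: comb_eq_0_iff)
  qed
  moreover have "0 \<in> lower_central (Suc (Suc (Suc (Suc 0))))"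
    unfolding lower_central.simps(2)[of "Suc (Suc (Suc 0))"] by (rule span_zero)
  ultimately have "lower_central (Suc (Suc (Suc (Suc 0)))) = {0}"
    unfolding span_empty by blast
  then have "nilpotent_lie_algebra L"
    by unfold_locales blast
  then show ?thesis unfolding nilpotent_of_dim_def lie_dim_def using dim_UNIV by blast
qed

end

section \<open>The nine algebras\<close>

lemma exhaust_5: "x = 1 \<or> x = 2 \<or> x = 3 \<or> x = 4 \<or> x = 5" for x :: 5
proof (induct x)
  case (of_int z)
  \<comment> \<open>The case \<open>z = 0\<close> is the numeral 5, which equals 0 in this
    type.\<close>
  then have "z = 0 \<or> z = 1 \<or> z = 2 \<or> z = 3 \<or> z = 4" by simp arith
  then show ?case by auto
qed

lemma forall_5: "(\<forall>i::5. P i) \<longleftrightarrow> P 1 \<and> P 2 \<and> P 3 \<and> P 4 \<and> P 5"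
  by (metis exhaust_5)

text \<open>Bilinearity and alternation hold for any list of products; only the Jacobi identity
  depends on the list and is left to be verified in coordinates.\<close>

lemma lie_algebra_of_products:
  assumes jacobi: "\<And>x y z :: 'f::field ^ 'n::finite.
      brack (lie_of_products ps) x (brack (lie_of_products ps) y z)
      + brack (lie_of_products ps) y (brack (lie_of_products ps) z x)
      + brack (lie_of_products ps) z (brack (lie_of_products ps) x y) = 0"
  shows "lie_algebra (lie_of_products ps :: ('f, 'f ^ 'n) lie_struct)"
proof -
  let ?B = "\<lambda>x y :: 'f ^ 'n. \<Sum>(i, j, k)\<leftarrow>ps. (x $ i * y $ j - x $ j * y $ i) *s axis k 1"
  have add: "?B (x + y) z = ?B x z + ?B y z" for x y z
    by (induction ps) (auto simp: algebra_simps vec.scale_left_distrib)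
  have scale: "?B (r *s x) z = r *s ?B x z" for r x z
    by (induction ps) (auto simp: algebra_simps vec.scale_right_distrib)
  have add': "?B z (x + y) = ?B z x + ?B z y" for x y z
    by (induction ps) (auto simp: algebra_simps vec.scale_left_distrib)
  have scale': "?B z (r *s x) = r *s ?B z x" for r x z
    by (induction ps) (auto simp: algebra_simps vec.scale_right_distrib)
  have self: "?B x x = 0" for x
  proof -
    have "(\<lambda>(i, j, k). (x $ i * x $ j - x $ j * x $ i) *s axis k 1) = (\<lambda>_. 0 :: 'f ^ 'n)"
      by (auto simp: fun_eq_iff mult.commute)
    then show ?thesis by simp
  qed
  have br: "brack (lie_of_products ps) = ?B" and sm: "smul (lie_of_products ps) = (*s)"
    by (simp_all add: lie_of_products_def)
  show ?thesis
    by unfold_locales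
      (unfold sm br, (rule add add' scale scale' self jacobi[unfolded br] vec.scale_right_distrib
        vec.scale_left_distrib vec.scale_scale vec.scale_one)+)
qed

lemma lie_algebra_I: "lie_algebra (lie_I :: ('f::field, 'f) lie_struct)"
  by unfold_locales (simp_all add: lie_I_def algebra_simps)

lemma smul_lie_sum:
  assumes "lie_algebra L" "lie_algebra M"
  shows "smul (L \<oplus>\<^sub>L M) r v = (smul L r (fst v), smul M r (snd v))"
proof -
  interpret L: lie_algebra L by fact
  interpret M: lie_algebra M by fact
  interpret module_prod "smul L" "smul M" by unfold_locales
  show ?thesis by (simp add: lie_sum_def scale_def)
qed

lemma brack_lie_sum:
  "brack (L \<oplus>\<^sub>L M) u v = (brack L (fst u) (fst v), brack M (snd u) (snd v))"
  by (simp add: lie_sum_def)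

lemma lie_algebra_sum:
  assumes "lie_algebra L" "lie_algebra M"
  shows "lie_algebra (L \<oplus>\<^sub>L M)"
proof -
  interpret L: lie_algebra L by fact
  interpret M: lie_algebra M by fact
  show ?thesis
    by unfold_locales (simp_all add: smul_lie_sum[OF assms] brack_lie_sum L.brack_simps M.brack_simps
      L.jacobi M.jacobi L.scale_left_distrib M.scale_left_distrib L.scale_right_distrib
      M.scale_right_distrib plus_prod_def zero_prod_def)
qed

lemma lie_algebra_L3: "lie_algebra (L3_1 :: ('f::field, 'f ^ 3) lie_struct)"
    "lie_algebra (L3_2 :: ('f::field, 'f ^ 3) lie_struct)"
  unfolding L3_1_def L3_2_def
  by (rule lie_algebra_of_products;
      simp add: lie_of_products_def vec_eq_iff forall_3 axis_def algebra_simps)+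

lemma lie_algebra_L4: "lie_algebra (L4_1 :: ('f::field, ('f ^ 3) \<times> 'f) lie_struct)"
    "lie_algebra (L4_2 :: ('f::field, ('f ^ 3) \<times> 'f) lie_struct)"
    "lie_algebra (L4_3 :: ('f::field, 'f ^ 4) lie_struct)"
proof -
  show "lie_algebra (L4_3 :: ('f::field, 'f ^ 4) lie_struct)"
    unfolding L4_3_def
    by (rule lie_algebra_of_products)
      (simp add: lie_of_products_def vec_eq_iff forall_4 axis_def algebra_simps)
qed (unfold L4_1_def L4_2_def, (intro lie_algebra_sum lie_algebra_L3 lie_algebra_I)+)

lemma lie_algebra_L5_1: "lie_algebra (L5_1 :: ('f::field, (('f ^ 3) \<times> 'f) \<times> 'f) lie_struct)"
  unfolding L5_1_def by (intro lie_algebra_sum lie_algebra_L4 lie_algebra_I)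

lemma lie_algebra_L5_2: "lie_algebra (L5_2 :: ('f::field, (('f ^ 3) \<times> 'f) \<times> 'f) lie_struct)"
  unfolding L5_2_def by (intro lie_algebra_sum lie_algebra_L4 lie_algebra_I)

lemma lie_algebra_L5_3: "lie_algebra (L5_3 :: ('f::field, ('f ^ 4) \<times> 'f) lie_struct)"
  unfolding L5_3_def by (intro lie_algebra_sum lie_algebra_L4 lie_algebra_I)

lemma lie_algebra_L5_4: "lie_algebra (L5_4 :: ('f::field, 'f ^ 5) lie_struct)"
  unfolding L5_4_def
  by (rule lie_algebra_of_products)
    (simp add: lie_of_products_def vec_eq_iff forall_5 axis_def algebra_simps)

lemma lie_algebra_L5_5: "lie_algebra (L5_5 :: ('f::field, 'f ^ 5) lie_struct)"
  unfolding L5_5_def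
  by (rule lie_algebra_of_products)
    (simp add: lie_of_products_def vec_eq_iff forall_5 axis_def algebra_simps)

lemma lie_algebra_L5_6: "lie_algebra (L5_6 :: ('f::field, 'f ^ 5) lie_struct)"
  unfolding L5_6_def
  by (rule lie_algebra_of_products)
    (simp add: lie_of_products_def vec_eq_iff forall_5 axis_def algebra_simps)

lemma lie_algebra_L5_7: "lie_algebra (L5_7 :: ('f::field, 'f ^ 5) lie_struct)"
  unfolding L5_7_def
  by (rule lie_algebra_of_products)
    (simp add: lie_of_products_def vec_eq_iff forall_5 axis_def algebra_simps)

lemma lie_algebra_L5_8: "lie_algebra (L5_8 :: ('f::field, 'f ^ 5) lie_struct)"
  unfolding L5_8_def
  by (rule lie_algebra_of_products)
    (simp add: lie_of_products_def vec_eq_iff forall_5 axis_def algebra_simps)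

lemma lie_algebra_L5_9: "lie_algebra (L5_9 :: ('f::field, 'f ^ 5) lie_struct)"
  unfolding L5_9_def
  by (rule lie_algebra_of_products)
    (simp add: lie_of_products_def vec_eq_iff forall_5 axis_def algebra_simps)

section \<open>Structure constants of the nine algebras\<close>

lemma adapted_L5_1: "adapted (L5_1 :: ('f::field, (('f ^ 3) \<times> 'f) \<times> 'f) lie_struct) 0 0 0 0 0 0 0 0 0 0"
proof -
  let ?L = "L5_1 :: ('f, (('f ^ 3) \<times> 'f) \<times> 'f) lie_struct"
  interpret lie_algebra ?L by (rule lie_algebra_L5_1)
  have smul: "smul ?L r v = ((r *s fst (fst v), r * snd (fst v)), r * snd v)" for r v
    unfolding L5_1_def smul_lie_sum[OF lie_algebra_L4(1) lie_algebra_I]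
    unfolding L4_1_def smul_lie_sum[OF lie_algebra_L3(1) lie_algebra_I]
    by (simp add: L3_1_def lie_of_products_def lie_I_def)
  have brack: "brack ?L u v = ((brack L3_1 (fst (fst u)) (fst (fst v)), 0), 0)" for u v
    by (simp add: L5_1_def L4_1_def brack_lie_sum lie_I_def)
  \<comment> \<open>The last two vectors span the two summands \<open>lie_I\<close>. Here and for
    the other eight algebras the given basis is adapted in its given order, so the constants are
    read off the listed products.\<close>
  have "adapted_basis ?L ((axis 1 1, 0), 0) ((axis 2 1, 0), 0) ((axis 3 1, 0), 0) ((0, 1), 0) ((0, 0), 1)
      0 0 0 0 0 0 0 0 0 0"
    by unfold_locales
      (auto simp: smul brack L3_1_def lie_of_products_def vec_eq_iff forall_3 axis_def prod_eq_iff)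
  then show ?thesis by (rule adaptedI)
qed

lemma adapted_L5_2: "adapted (L5_2 :: ('f::field, (('f ^ 3) \<times> 'f) \<times> 'f) lie_struct) 1 0 0 0 0 0 0 0 0 0"
proof -
  let ?L = "L5_2 :: ('f, (('f ^ 3) \<times> 'f) \<times> 'f) lie_struct"
  interpret lie_algebra ?L by (rule lie_algebra_L5_2)
  have smul: "smul ?L r v = ((r *s fst (fst v), r * snd (fst v)), r * snd v)" for r v
    unfolding L5_2_def smul_lie_sum[OF lie_algebra_L4(2) lie_algebra_I]
    unfolding L4_2_def smul_lie_sum[OF lie_algebra_L3(2) lie_algebra_I]
    by (simp add: L3_2_def lie_of_products_def lie_I_def)
  have brack: "brack ?L u v = ((brack L3_2 (fst (fst u)) (fst (fst v)), 0), 0)" for u v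
    by (simp add: L5_2_def L4_2_def brack_lie_sum lie_I_def)
  have "adapted_basis ?L ((axis 1 1, 0), 0) ((axis 2 1, 0), 0) ((axis 3 1, 0), 0) ((0, 1), 0) ((0, 0), 1)
      1 0 0 0 0 0 0 0 0 0"
    by unfold_locales
      (auto simp: smul brack L3_2_def lie_of_products_def vec_eq_iff forall_3 axis_def prod_eq_iff)
  then show ?thesis by (rule adaptedI)
qed

lemma adapted_L5_3: "adapted (L5_3 :: ('f::field, ('f ^ 4) \<times> 'f) lie_struct) 1 0 0 1 0 0 0 0 0 0"
proof -
  let ?L = "L5_3 :: ('f, ('f ^ 4) \<times> 'f) lie_struct"
  interpret lie_algebra ?L by (rule lie_algebra_L5_3)
  have smul: "smul ?L r v = (r *s fst v, r * snd v)" for r v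
    unfolding L5_3_def smul_lie_sum[OF lie_algebra_L4(3) lie_algebra_I]
    by (simp add: L4_3_def lie_of_products_def lie_I_def)
  have brack: "brack ?L u v = (brack L4_3 (fst u) (fst v), 0)" for u v
    by (simp add: L5_3_def brack_lie_sum lie_I_def)
  have "adapted_basis ?L (axis 1 1, 0) (axis 2 1, 0) (axis 3 1, 0) (axis 4 1, 0) (0, 1) 1 0 0 1 0 0 0 0 0 0"
    by unfold_locales
      (auto simp: smul brack L4_3_def lie_of_products_def vec_eq_iff forall_4 axis_def prod_eq_iff)
  then show ?thesis by (rule adaptedI)
qed

lemma adapted_L5_4: "adapted (L5_4 :: ('f::field, 'f ^ 5) lie_struct) 0 0 1 0 0 0 0 0 0 1"
proof -
  interpret lie_algebra "L5_4 :: ('f, 'f ^ 5) lie_struct" by (rule lie_algebra_L5_4)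
  have "adapted_basis (L5_4 :: ('f, 'f ^ 5) lie_struct)
      (axis 1 1) (axis 2 1) (axis 3 1) (axis 4 1) (axis 5 1) 0 0 1 0 0 0 0 0 0 1"
    by unfold_locales (auto simp: L5_4_def lie_of_products_def vec_eq_iff forall_5 axis_def)
  then show ?thesis by (rule adaptedI)
qed

lemma adapted_L5_5: "adapted (L5_5 :: ('f::field, 'f ^ 5) lie_struct) 1 0 0 0 1 0 0 0 1 0"
proof -
  interpret lie_algebra "L5_5 :: ('f, 'f ^ 5) lie_struct" by (rule lie_algebra_L5_5)
  have "adapted_basis (L5_5 :: ('f, 'f ^ 5) lie_struct)
      (axis 1 1) (axis 2 1) (axis 3 1) (axis 4 1) (axis 5 1) 1 0 0 0 1 0 0 0 1 0"
    by unfold_locales (auto simp: L5_5_def lie_of_products_def vec_eq_iff forall_5 axis_def)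
  then show ?thesis by (rule adaptedI)
qed

lemma adapted_L5_6: "adapted (L5_6 :: ('f::field, 'f ^ 5) lie_struct) 1 0 0 1 0 0 1 1 0 0"
proof -
  interpret lie_algebra "L5_6 :: ('f, 'f ^ 5) lie_struct" by (rule lie_algebra_L5_6)
  have "adapted_basis (L5_6 :: ('f, 'f ^ 5) lie_struct)
      (axis 1 1) (axis 2 1) (axis 3 1) (axis 4 1) (axis 5 1) 1 0 0 1 0 0 1 1 0 0"
    by unfold_locales (auto simp: L5_6_def lie_of_products_def vec_eq_iff forall_5 axis_def)
  then show ?thesis by (rule adaptedI)
qed

lemma adapted_L5_7: "adapted (L5_7 :: ('f::field, 'f ^ 5) lie_struct) 1 0 0 1 0 0 0 1 0 0"
proof -
  interpret lie_algebra "L5_7 :: ('f, 'f ^ 5) lie_struct" by (rule lie_algebra_L5_7)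
  have "adapted_basis (L5_7 :: ('f, 'f ^ 5) lie_struct)
      (axis 1 1) (axis 2 1) (axis 3 1) (axis 4 1) (axis 5 1) 1 0 0 1 0 0 0 1 0 0"
    by unfold_locales (auto simp: L5_7_def lie_of_products_def vec_eq_iff forall_5 axis_def)
  then show ?thesis by (rule adaptedI)
qed

lemma adapted_L5_8: "adapted (L5_8 :: ('f::field, 'f ^ 5) lie_struct) 0 1 0 0 1 0 0 0 0 0"
proof -
  interpret lie_algebra "L5_8 :: ('f, 'f ^ 5) lie_struct" by (rule lie_algebra_L5_8)
  have "adapted_basis (L5_8 :: ('f, 'f ^ 5) lie_struct)
      (axis 1 1) (axis 2 1) (axis 3 1) (axis 4 1) (axis 5 1) 0 1 0 0 1 0 0 0 0 0"
    by unfold_locales (auto simp: L5_8_def lie_of_products_def vec_eq_iff forall_5 axis_def)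
  then show ?thesis by (rule adaptedI)
qed

lemma adapted_L5_9: "adapted (L5_9 :: ('f::field, 'f ^ 5) lie_struct) 1 0 0 1 0 0 1 0 0 0"
proof -
  interpret lie_algebra "L5_9 :: ('f, 'f ^ 5) lie_struct" by (rule lie_algebra_L5_9)
  have "adapted_basis (L5_9 :: ('f, 'f ^ 5) lie_struct)
      (axis 1 1) (axis 2 1) (axis 3 1) (axis 4 1) (axis 5 1) 1 0 0 1 0 0 1 0 0 0"
    by unfold_locales (auto simp: L5_9_def lie_of_products_def vec_eq_iff forall_5 axis_def)
  then show ?thesis by (rule adaptedI)
qed

section \<open>Invariants\<close>

definition is_standard :: "nat \<Rightarrow> ('f::field, 'v::ab_group_add) lie_struct \<Rightarrow> bool" where
  "is_standard k L \<longleftrightarrow>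
     k = 1 \<and> adapted L 0 0 0 0 0 0 0 0 0 0 \<or> k = 2 \<and> adapted L 1 0 0 0 0 0 0 0 0 0 \<or>
     k = 3 \<and> adapted L 1 0 0 1 0 0 0 0 0 0 \<or> k = 4 \<and> adapted L 0 0 1 0 0 0 0 0 0 1 \<or>
     k = 5 \<and> adapted L 1 0 0 0 1 0 0 0 1 0 \<or> k = 6 \<and> adapted L 1 0 0 1 0 0 1 1 0 0 \<or>
     k = 7 \<and> adapted L 1 0 0 1 0 0 0 1 0 0 \<or> k = 8 \<and> adapted L 0 1 0 0 1 0 0 0 0 0 \<or>
     k = 9 \<and> adapted L 1 0 0 1 0 0 1 0 0 0"

definition centralizes_derived where
  "centralizes_derived L x \<longleftrightarrow> (\<forall>y z. brack L x (brack L y z) = 0)"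

text \<open>A decision tree along the nilpotency class: abelian, two, three, and higher. In class
  two, non-proportional products single out 8, and two mutually commuting pairs with non-zero
  products tell the five-dimensional Heisenberg algebra 4 from 2. No test refers to a basis.\<close>

definition standard_index :: "('f::field, 'v::ab_group_add) lie_struct \<Rightarrow> nat" where
  "standard_index L =
    (if \<forall>x y. brack L x y = 0 then 1
     else if \<forall>x. centralizes_derived L x then
       (if \<exists>x y z w. brack L x y \<noteq> 0 \<and> (\<forall>r. brack L z w \<noteq> smul L r (brack L x y)) then 8
        else if \<exists>x y z w. brack L x y \<noteq> 0 \<and> brack L z w \<noteq> 0 \<and> brack L x z = 0 \<and> brack L x w = 0 \<and>
          brack L y z = 0 \<and> brack L y w = 0 then 4
        else 2)
     else if \<forall>x y z w. brack L x (brack L y (brack L z w)) = 0 then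
       (if \<exists>x y. centralizes_derived L x \<and> centralizes_derived L y \<and> brack L x y \<noteq> 0 then 5
        else if \<exists>x y. centralizes_derived L x \<and> brack L y (brack L y x) \<noteq> 0 then 3 else 9)
     else if \<exists>x y. centralizes_derived L x \<and> brack L y (brack L y (brack L y x)) \<noteq> 0 then 7 else 6)"

text \<open>Serves for the algebras 2 and 4, whose derived algebra is a line.\<close>

lemma (in lie_algebra) brack_proportional:
  assumes "\<And>x y. \<exists>p. brack L x y = smul L p u"
  shows "\<not> (\<exists>x y z w. brack L x y \<noteq> 0 \<and> (\<forall>r. brack L z w \<noteq> smul L r (brack L x y)))"
proof (intro notI, elim exE conjE)
  fix x y z w
  assume nz: "brack L x y \<noteq> 0" and ne: "\<forall>r. brack L z w \<noteq> smul L r (brack L x y)"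
  obtain p q where p: "brack L x y = smul L p u" and q: "brack L z w = smul L q u"
    using assms by meson
  have "p \<noteq> 0" using nz p by auto
  then have "brack L z w = smul L (q / p) (brack L x y)" unfolding p q by simp
  then show False using ne by blast
qed

lemma homogeneous_system_2x2:
  fixes x y :: "'a::field"
  assumes "d * g \<noteq> e * f" "x * d + y * f = 0" "x * e + y * g = 0"
  shows "x = 0 \<and> y = 0"
proof -
  have "x * (d * g - e * f) = 0" "y * (d * g - e * f) = 0"
    using assms(2,3) by algebra+
  then show ?thesis using assms(1) by simp
qed

text \<open>In the plane, a vector parallel to two non-parallel vectors vanishes:
  \<open>(z2, - z1)\<close> solves a homogeneous system with non-zero determinant.\<close>

lemma cross_product_zero:
  fixes x1 x2 y1 y2 z1 z2 :: "'a::field"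
  assumes "x1 * y2 \<noteq> x2 * y1" "y1 * z2 = y2 * z1" "x1 * z2 = x2 * z1"
  shows "z1 = 0 \<and> z2 = 0"
  using homogeneous_system_2x2[of x1 y2 y1 x2 z2 "- z1"] assms by (simp add: mult.commute)

lemma standard_index_1:
  assumes "adapted L 0 0 0 0 0 0 0 0 0 0"
  shows "standard_index L = 1"
proof -
  obtain v1 v2 v3 v4 v5 where "adapted_basis L v1 v2 v3 v4 v5 0 0 0 0 0 0 0 0 0 0"
    using assms by (rule adaptedE)
  then interpret adapted_basis L v1 v2 v3 v4 v5 0 0 0 0 0 0 0 0 0 0 .
  have c1: "(\<forall>x y. brack L x y = 0)"
    unfolding all_comb by (simp add: brack_comb comb_eq_0_iff)
  show ?thesis
    unfolding standard_index_def by (simp only: if_P[OF c1])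
qed

lemma standard_index_2:
  assumes "adapted L 1 0 0 0 0 0 0 0 0 0"
  shows "standard_index L = 2"
proof -
  obtain v1 v2 v3 v4 v5 where "adapted_basis L v1 v2 v3 v4 v5 1 0 0 0 0 0 0 0 0 0"
    using assms by (rule adaptedE)
  then interpret adapted_basis L v1 v2 v3 v4 v5 1 0 0 0 0 0 0 0 0 0 .
  have c1: "\<not> (\<forall>x y. brack L x y = 0)"
    by (intro notI,
        drule spec[of _ "comb 1 0 0 0 0"],
        drule spec[of _ "comb 0 1 0 0 0"])
        (simp add: brack_comb comb_eq_0_iff)
  have c2: "(\<forall>x. centralizes_derived L x)"
    unfolding centralizes_derived_def all_comb by (simp add: brack_comb comb_eq_0_iff)
  have c3: "\<not> (\<exists>x y z w. brack L x y \<noteq> 0 \<and> (\<forall>r. brack L z w \<noteq> smul L r (brack L x y)))"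
  proof (rule brack_proportional)
    fix x y
    obtain x1 x2 x3 x4 x5 where x: "x = comb x1 x2 x3 x4 x5" using ex_comb by blast
    obtain y1 y2 y3 y4 y5 where y: "y = comb y1 y2 y3 y4 y5" using ex_comb by blast
    show "\<exists>p. brack L x y = smul L p v3"
      unfolding x y brack_comb by (intro exI) (simp add: comb_def del: scale_cancel_right)
  qed
  \<comment> \<open>Only the first two coordinates enter a bracket. If \<open>z\<close> commutes
    with \<open>x\<close> and \<open>y\<close> but these do not commute, then both coordinates of
    \<open>z\<close> vanish and so does \<open>[z, w]\<close>.\<close>
  have c4: "\<not> (\<exists>x y z w. brack L x y \<noteq> 0 \<and> brack L z w \<noteq> 0 \<and> brack L x z = 0 \<and> brack L x w = 0
      \<and> brack L y z = 0 \<and> brack L y w = 0)"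
    unfolding ex_comb_iff by (simp add: brack_comb comb_eq_0_iff) (metis cross_product_zero mult_zero_left)
  show ?thesis
    unfolding standard_index_def
    by (simp only: if_not_P[OF c1] if_P[OF c2] if_not_P[OF c3] if_not_P[OF c4])
qed

lemma standard_index_3:
  assumes "adapted L 1 0 0 1 0 0 0 0 0 0"
  shows "standard_index L = 3"
proof -
  obtain v1 v2 v3 v4 v5 where "adapted_basis L v1 v2 v3 v4 v5 1 0 0 1 0 0 0 0 0 0"
    using assms by (rule adaptedE)
  then interpret adapted_basis L v1 v2 v3 v4 v5 1 0 0 1 0 0 0 0 0 0 .
  have cd: "centralizes_derived L (comb x1 x2 x3 x4 x5) \<longleftrightarrow> x1 = 0" for x1 x2 x3 x4 x5
  proof
    assume "centralizes_derived L (comb x1 x2 x3 x4 x5)"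
    \<comment> \<open>\<open>[v1, v2] = v3\<close> lies in the derived algebra, and bracketing with
      it detects \<open>x1\<close>.\<close>
    then have "brack L (comb x1 x2 x3 x4 x5) (brack L (comb 1 0 0 0 0) (comb 0 1 0 0 0)) = 0"
      unfolding centralizes_derived_def by blast
    then show "x1 = 0" by (simp add: brack_comb comb_eq_0_iff)
  next
    assume "x1 = 0"
    then show "centralizes_derived L (comb x1 x2 x3 x4 x5)"
      unfolding centralizes_derived_def all_comb by (simp add: brack_comb comb_eq_0_iff)
  qed
  have c1: "\<not> (\<forall>x y. brack L x y = 0)"
    by (intro notI,
        drule spec[of _ "comb 1 0 0 0 0"],
        drule spec[of _ "comb 0 1 0 0 0"])
        (simp add: brack_comb comb_eq_0_iff)
  have c2: "\<not> (\<forall>x. centralizes_derived L x)"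
    using cd[of 1 0 0 0 0] by auto
  have c3: "(\<forall>x y z w. brack L x (brack L y (brack L z w)) = 0)"
    unfolding all_comb by (simp add: brack_comb comb_eq_0_iff)
  \<comment> \<open>The centralizer of the derived algebra is the span of
    \<open>v2, ..., v5\<close>, which is abelian here.\<close>
  have c4: "\<not> (\<exists>x y. centralizes_derived L x \<and> centralizes_derived L y \<and> brack L x y \<noteq> 0)"
    unfolding ex_comb_iff by (auto simp: brack_comb comb_eq_0_iff cd)
  have c5: "(\<exists>x y. centralizes_derived L x \<and> brack L y (brack L y x) \<noteq> 0)"
    by (rule exI[of _ "comb 0 1 0 0 0"],
        rule exI[of _ "comb 1 0 0 0 0"])
        (simp add: brack_comb comb_eq_0_iff cd)
  show ?thesis
    unfolding standard_index_def
    by (simp only: if_not_P[OF c1] if_not_P[OF c2] if_P[OF c3] if_not_P[OF c4] if_P[OF c5])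
qed

lemma standard_index_4:
  assumes "adapted L 0 0 1 0 0 0 0 0 0 1"
  shows "standard_index L = 4"
proof -
  obtain v1 v2 v3 v4 v5 where "adapted_basis L v1 v2 v3 v4 v5 0 0 1 0 0 0 0 0 0 1"
    using assms by (rule adaptedE)
  then interpret adapted_basis L v1 v2 v3 v4 v5 0 0 1 0 0 0 0 0 0 1 .
  have c1: "\<not> (\<forall>x y. brack L x y = 0)"
    by (intro notI,
        drule spec[of _ "comb 1 0 0 0 0"],
        drule spec[of _ "comb 0 1 0 0 0"])
        (simp add: brack_comb comb_eq_0_iff)
  have c2: "(\<forall>x. centralizes_derived L x)"
    unfolding centralizes_derived_def all_comb by (simp add: brack_comb comb_eq_0_iff)
  have c3: "\<not> (\<exists>x y z w. brack L x y \<noteq> 0 \<and> (\<forall>r. brack L z w \<noteq> smul L r (brack L x y)))"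
  proof (rule brack_proportional)
    fix x y
    obtain x1 x2 x3 x4 x5 where x: "x = comb x1 x2 x3 x4 x5" using ex_comb by blast
    obtain y1 y2 y3 y4 y5 where y: "y = comb y1 y2 y3 y4 y5" using ex_comb by blast
    show "\<exists>p. brack L x y = smul L p v5"
      unfolding x y brack_comb by (intro exI) (simp add: comb_def del: scale_cancel_right)
  qed
  have c4: "(\<exists>x y z w. brack L x y \<noteq> 0 \<and> brack L z w \<noteq> 0 \<and> brack L x z = 0 \<and> brack L x w = 0
      \<and> brack L y z = 0 \<and> brack L y w = 0)"
    by (rule exI[of _ "comb 1 0 0 0 0"],
        rule exI[of _ "comb 0 1 0 0 0"],
        rule exI[of _ "comb 0 0 1 0 0"],
        rule exI[of _ "comb 0 0 0 1 0"])
        (simp add: brack_comb comb_eq_0_iff)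
  show ?thesis
    unfolding standard_index_def
    by (simp only: if_not_P[OF c1] if_P[OF c2] if_not_P[OF c3] if_P[OF c4])
qed

lemma standard_index_5:
  assumes "adapted L 1 0 0 0 1 0 0 0 1 0"
  shows "standard_index L = 5"
proof -
  obtain v1 v2 v3 v4 v5 where "adapted_basis L v1 v2 v3 v4 v5 1 0 0 0 1 0 0 0 1 0"
    using assms by (rule adaptedE)
  then interpret adapted_basis L v1 v2 v3 v4 v5 1 0 0 0 1 0 0 0 1 0 .
  have cd: "centralizes_derived L (comb x1 x2 x3 x4 x5) \<longleftrightarrow> x1 = 0" for x1 x2 x3 x4 x5
  proof
    assume "centralizes_derived L (comb x1 x2 x3 x4 x5)"
    then have "brack L (comb x1 x2 x3 x4 x5) (brack L (comb 1 0 0 0 0) (comb 0 1 0 0 0)) = 0"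
      unfolding centralizes_derived_def by blast
    then show "x1 = 0" by (simp add: brack_comb comb_eq_0_iff)
  next
    assume "x1 = 0"
    then show "centralizes_derived L (comb x1 x2 x3 x4 x5)"
      unfolding centralizes_derived_def all_comb by (simp add: brack_comb comb_eq_0_iff)
  qed
  have c1: "\<not> (\<forall>x y. brack L x y = 0)"
    by (intro notI,
        drule spec[of _ "comb 1 0 0 0 0"],
        drule spec[of _ "comb 0 1 0 0 0"])
        (simp add: brack_comb comb_eq_0_iff)
  have c2: "\<not> (\<forall>x. centralizes_derived L x)"
    using cd[of 1 0 0 0 0] by auto
  have c3: "(\<forall>x y z w. brack L x (brack L y (brack L z w)) = 0)"
    unfolding all_comb by (simp add: brack_comb comb_eq_0_iff)
  \<comment> \<open>The centralizer is again the span of \<open>v2, ..., v5\<close>, but now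
    \<open>[v2, v4] = v5\<close>.\<close>
  have c4: "(\<exists>x y. centralizes_derived L x \<and> centralizes_derived L y \<and> brack L x y \<noteq> 0)"
    by (rule exI[of _ "comb 0 1 0 0 0"],
        rule exI[of _ "comb 0 0 0 1 0"])
        (simp add: brack_comb comb_eq_0_iff cd)
  show ?thesis
    unfolding standard_index_def
    by (simp only: if_not_P[OF c1] if_not_P[OF c2] if_P[OF c3] if_P[OF c4])
qed

lemma standard_index_6:
  assumes "adapted L 1 0 0 1 0 0 1 1 0 0"
  shows "standard_index L = 6"
proof -
  obtain v1 v2 v3 v4 v5 where "adapted_basis L v1 v2 v3 v4 v5 1 0 0 1 0 0 1 1 0 0"
    using assms by (rule adaptedE)
  then interpret adapted_basis L v1 v2 v3 v4 v5 1 0 0 1 0 0 1 1 0 0 .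
  have cd: "centralizes_derived L (comb x1 x2 x3 x4 x5) \<longleftrightarrow> x1 = 0 \<and> x2 = 0" for x1 x2 x3 x4 x5
  proof
    assume "centralizes_derived L (comb x1 x2 x3 x4 x5)"
    then have "brack L (comb x1 x2 x3 x4 x5) (brack L (comb 1 0 0 0 0) (comb 0 1 0 0 0)) = 0"
      unfolding centralizes_derived_def by blast
    then show "x1 = 0 \<and> x2 = 0" by (simp add: brack_comb comb_eq_0_iff)
  next
    assume "x1 = 0 \<and> x2 = 0"
    then show "centralizes_derived L (comb x1 x2 x3 x4 x5)"
      unfolding centralizes_derived_def all_comb by (simp add: brack_comb comb_eq_0_iff)
  qed
  have c1: "\<not> (\<forall>x y. brack L x y = 0)"
    by (intro notI,
        drule spec[of _ "comb 1 0 0 0 0"],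
        drule spec[of _ "comb 0 1 0 0 0"])
        (simp add: brack_comb comb_eq_0_iff)
  have c2: "\<not> (\<forall>x. centralizes_derived L x)"
    using cd[of 1 0 0 0 0] by auto
  have c3: "\<not> (\<forall>x y z w. brack L x (brack L y (brack L z w)) = 0)"
    by (intro notI,
        drule spec[of _ "comb 1 0 0 0 0"],
        drule spec[of _ "comb 1 0 0 0 0"],
        drule spec[of _ "comb 1 0 0 0 0"],
        drule spec[of _ "comb 0 1 0 0 0"])
        (simp add: brack_comb comb_eq_0_iff)
  \<comment> \<open>The centralizer is only the span of \<open>v3, v4, v5\<close>, and three
    bracketings with \<open>y\<close> kill it.\<close>
  have c4: "\<not> (\<exists>x y. centralizes_derived L x \<and> brack L y (brack L y (brack L y x)) \<noteq> 0)"
    unfolding ex_comb_iff by (auto simp: brack_comb comb_eq_0_iff cd)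
  show ?thesis
    unfolding standard_index_def
    by (simp only: if_not_P[OF c1] if_not_P[OF c2] if_not_P[OF c3] if_not_P[OF c4])
qed

lemma standard_index_7:
  assumes "adapted L 1 0 0 1 0 0 0 1 0 0"
  shows "standard_index L = 7"
proof -
  obtain v1 v2 v3 v4 v5 where "adapted_basis L v1 v2 v3 v4 v5 1 0 0 1 0 0 0 1 0 0"
    using assms by (rule adaptedE)
  then interpret adapted_basis L v1 v2 v3 v4 v5 1 0 0 1 0 0 0 1 0 0 .
  have cd: "centralizes_derived L (comb x1 x2 x3 x4 x5) \<longleftrightarrow> x1 = 0" for x1 x2 x3 x4 x5
  proof
    assume "centralizes_derived L (comb x1 x2 x3 x4 x5)"
    then have "brack L (comb x1 x2 x3 x4 x5) (brack L (comb 1 0 0 0 0) (comb 0 1 0 0 0)) = 0"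
      unfolding centralizes_derived_def by blast
    then show "x1 = 0" by (simp add: brack_comb comb_eq_0_iff)
  next
    assume "x1 = 0"
    then show "centralizes_derived L (comb x1 x2 x3 x4 x5)"
      unfolding centralizes_derived_def all_comb by (simp add: brack_comb comb_eq_0_iff)
  qed
  have c1: "\<not> (\<forall>x y. brack L x y = 0)"
    by (intro notI,
        drule spec[of _ "comb 1 0 0 0 0"],
        drule spec[of _ "comb 0 1 0 0 0"])
        (simp add: brack_comb comb_eq_0_iff)
  have c2: "\<not> (\<forall>x. centralizes_derived L x)"
    using cd[of 1 0 0 0 0] by auto
  have c3: "\<not> (\<forall>x y z w. brack L x (brack L y (brack L z w)) = 0)"
    by (intro notI,
        drule spec[of _ "comb 1 0 0 0 0"],
        drule spec[of _ "comb 1 0 0 0 0"],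
        drule spec[of _ "comb 1 0 0 0 0"],
        drule spec[of _ "comb 0 1 0 0 0"])
        (simp add: brack_comb comb_eq_0_iff)
  \<comment> \<open>Now \<open>v2\<close> centralizes the derived algebra, and three brackets with
    \<open>v1\<close> lead from it to \<open>v5\<close>.\<close>
  have c4: "(\<exists>x y. centralizes_derived L x \<and> brack L y (brack L y (brack L y x)) \<noteq> 0)"
    by (rule exI[of _ "comb 0 1 0 0 0"],
        rule exI[of _ "comb 1 0 0 0 0"])
        (simp add: brack_comb comb_eq_0_iff cd)
  show ?thesis
    unfolding standard_index_def
    by (simp only: if_not_P[OF c1] if_not_P[OF c2] if_not_P[OF c3] if_P[OF c4])
qed

lemma standard_index_8:
  assumes "adapted L 0 1 0 0 1 0 0 0 0 0"
  shows "standard_index L = 8"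
proof -
  obtain v1 v2 v3 v4 v5 where "adapted_basis L v1 v2 v3 v4 v5 0 1 0 0 1 0 0 0 0 0"
    using assms by (rule adaptedE)
  then interpret adapted_basis L v1 v2 v3 v4 v5 0 1 0 0 1 0 0 0 0 0 .
  have c1: "\<not> (\<forall>x y. brack L x y = 0)"
    by (intro notI,
        drule spec[of _ "comb 1 0 0 0 0"],
        drule spec[of _ "comb 0 1 0 0 0"])
        (simp add: brack_comb comb_eq_0_iff)
  have c2: "(\<forall>x. centralizes_derived L x)"
    unfolding centralizes_derived_def all_comb by (simp add: brack_comb comb_eq_0_iff)
  have c3: "(\<exists>x y z w. brack L x y \<noteq> 0 \<and> (\<forall>r. brack L z w \<noteq> smul L r (brack L x y)))"
    by (rule exI[of _ "comb 1 0 0 0 0"],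
        rule exI[of _ "comb 0 1 0 0 0"],
        rule exI[of _ "comb 1 0 0 0 0"],
        rule exI[of _ "comb 0 0 1 0 0"])
        (simp add: brack_comb comb_eq_0_iff smul_comb comb_eq_iff)
  show ?thesis
    unfolding standard_index_def by (simp only: if_not_P[OF c1] if_P[OF c2] if_P[OF c3])
qed

lemma standard_index_9:
  assumes "adapted L 1 0 0 1 0 0 1 0 0 0"
  shows "standard_index L = 9"
proof -
  obtain v1 v2 v3 v4 v5 where "adapted_basis L v1 v2 v3 v4 v5 1 0 0 1 0 0 1 0 0 0"
    using assms by (rule adaptedE)
  then interpret adapted_basis L v1 v2 v3 v4 v5 1 0 0 1 0 0 1 0 0 0 .
  have cd: "centralizes_derived L (comb x1 x2 x3 x4 x5) \<longleftrightarrow> x1 = 0 \<and> x2 = 0" for x1 x2 x3 x4 x5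
  proof
    assume "centralizes_derived L (comb x1 x2 x3 x4 x5)"
    then have "brack L (comb x1 x2 x3 x4 x5) (brack L (comb 1 0 0 0 0) (comb 0 1 0 0 0)) = 0"
      unfolding centralizes_derived_def by blast
    then show "x1 = 0 \<and> x2 = 0" by (simp add: brack_comb comb_eq_0_iff)
  next
    assume "x1 = 0 \<and> x2 = 0"
    then show "centralizes_derived L (comb x1 x2 x3 x4 x5)"
      unfolding centralizes_derived_def all_comb by (simp add: brack_comb comb_eq_0_iff)
  qed
  have c1: "\<not> (\<forall>x y. brack L x y = 0)"
    by (intro notI,
        drule spec[of _ "comb 1 0 0 0 0"],
        drule spec[of _ "comb 0 1 0 0 0"])
        (simp add: brack_comb comb_eq_0_iff)
  have c2: "\<not> (\<forall>x. centralizes_derived L x)"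
    using cd[of 1 0 0 0 0] by auto
  have c3: "(\<forall>x y z w. brack L x (brack L y (brack L z w)) = 0)"
    unfolding all_comb by (simp add: brack_comb comb_eq_0_iff)
  \<comment> \<open>The centralizer is the span of \<open>v3, v4, v5\<close>; it is abelian, and one
    bracket sends it into the center, spanned by \<open>v4\<close> and \<open>v5\<close>.\<close>
  have c4: "\<not> (\<exists>x y. centralizes_derived L x \<and> centralizes_derived L y \<and> brack L x y \<noteq> 0)"
    unfolding ex_comb_iff by (auto simp: brack_comb comb_eq_0_iff cd)
  have c5: "\<not> (\<exists>x y. centralizes_derived L x \<and> brack L y (brack L y x) \<noteq> 0)"
    unfolding ex_comb_iff by (auto simp: brack_comb comb_eq_0_iff cd)
  show ?thesis
    unfolding standard_index_def
    by (simp only: if_not_P[OF c1] if_not_P[OF c2] if_P[OF c3] if_not_P[OF c4] if_not_P[OF c5])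
qed

text \<open>Yields uniqueness of the index, since \<open>standard_index\<close> is a function of the
  algebra.\<close>

lemma standard_index: "is_standard k L \<Longrightarrow> standard_index L = k"
  unfolding is_standard_def
  using standard_index_1[of L] standard_index_2[of L] standard_index_3[of L]
    standard_index_4[of L] standard_index_5[of L] standard_index_6[of L]
    standard_index_7[of L] standard_index_8[of L] standard_index_9[of L]
  by blast

section \<open>Changes of adapted basis\<close>

context adapted_basis
begin

text \<open>These are the \<open>v5\<close> coefficients of the Jacobi identity for
  \<open>v1, v2, v4\<close> and for \<open>v1, v2, v3\<close>.\<close>

lemma jacobi_coeffs: "a * j = 0" "f * h - d * i + b * j = 0"
  using jacobi[of "comb 1 0 0 0 0" "comb 0 1 0 0 0" "comb 0 0 0 1 0"]
    jacobi[of "comb 1 0 0 0 0" "comb 0 1 0 0 0" "comb 0 0 1 0 0"]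
  by (simp_all add: brack_comb comb_add comb_eq_0_iff algebra_simps)

text \<open>Frame for all changes of basis: new vectors are given in old coordinates, and
  \<open>rebase_simps\<close> turns the premises into field equations. As \<open>adapted\<close>
  forgets the basis, each change is an implication between tuples of constants.\<close>

lemma rebase:
  assumes "indep5 w1 w2 w3 w4 w5"
    and "brack L w1 w2 = smul L a' w3 + smul L b' w4 + smul L c' w5"
      "brack L w1 w3 = smul L d' w4 + smul L e' w5"
      "brack L w2 w3 = smul L f' w4 + smul L g' w5"
      "brack L w1 w4 = smul L h' w5"
      "brack L w2 w4 = smul L i' w5"
      "brack L w3 w4 = smul L j' w5"
      "brack L w1 w5 = 0" "brack L w2 w5 = 0" "brack L w3 w5 = 0" "brack L w4 w5 = 0"
  shows "adapted L a' b' c' d' e' f' g' h' i' j'"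
  using adapted_basisI[OF dim_UNIV assms] by (rule adaptedI)

lemmas rebase_simps = indep5_def brack_comb smul_comb comb_add comb_eq_iff comb_eq_0_iff

end

text \<open>Exchanging \<open>v1\<close> and \<open>v2\<close> allows \<open>h \<noteq> 0\<close> to
  be assumed when one of \<open>h\<close>, \<open>i\<close> is non-zero, and likewise for
  \<open>d\<close>, \<open>f\<close>.\<close>

lemma adapted_swap:
  assumes "adapted L a b c d e f g h i j"
  shows "adapted L (- a) (- b) (- c) f g d e i h j"
proof -
  obtain v1 v2 v3 v4 v5 where "adapted_basis L v1 v2 v3 v4 v5 a b c d e f g h i j"
    using assms(1) by (rule adaptedE)
  then interpret adapted_basis L v1 v2 v3 v4 v5 a b c d e f g h i j .
  show ?thesis
    by (intro rebase[of "comb 0 1 0 0 0"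
        "comb 1 0 0 0 0"
        "comb 0 0 1 0 0"
        "comb 0 0 0 1 0"
        "comb 0 0 0 0 1"])
      (auto simp: rebase_simps field_simps)
qed

section \<open>Case (A): \<open>[v3, v4]\<close> is non-zero\<close>

lemma adapted_A:
  assumes "adapted L a b c d e f g h i j"
    and "j \<noteq> 0"
  shows "adapted L 0 0 ((c - e * i / j + g * h / j) / j) d 0 f 0 0 0 1"
proof -
  obtain v1 v2 v3 v4 v5 where "adapted_basis L v1 v2 v3 v4 v5 a b c d e f g h i j"
    using assms(1) by (rule adaptedE)
  then interpret adapted_basis L v1 v2 v3 v4 v5 a b c d e f g h i j .
  \<comment> \<open>Multiples of \<open>v3\<close> and \<open>v4\<close> added to \<open>v1\<close>
    and \<open>v2\<close> cancel \<open>h\<close>, \<open>i\<close>, \<open>e\<close> and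
    \<open>g\<close>. The Jacobi relations give \<open>a = 0\<close> and make the new
    \<open>v4\<close> coefficient of \<open>[v1, v2]\<close> vanish; rescaling \<open>v5\<close>
    turns \<open>j\<close> into 1.\<close>
  show ?thesis
    using assms(2-) jacobi_coeffs
    by (intro rebase[of "comb 1 0 (- h / j) (e / j) 0"
        "comb 0 1 (- i / j) (g / j) 0"
        "comb 0 0 1 0 0"
        "comb 0 0 0 1 0"
        "comb 0 0 0 0 j"])
      (auto simp: rebase_simps field_simps)
qed

lemma adapted_A_shear:
  assumes "adapted L 0 0 c d 0 f 0 0 0 1"
    and "d \<noteq> 0"
  shows "adapted L 0 0 c d 0 0 0 0 0 1"
proof -
  obtain v1 v2 v3 v4 v5 where "adapted_basis L v1 v2 v3 v4 v5 0 0 c d 0 f 0 0 0 1"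
    using assms(1) by (rule adaptedE)
  then interpret adapted_basis L v1 v2 v3 v4 v5 0 0 c d 0 f 0 0 0 1 .
  show ?thesis
    using assms(2-)
    by (intro rebase[of "comb 1 0 0 0 0"
        "comb (- f / d) 1 0 0 0"
        "comb 0 0 1 0 0"
        "comb 0 0 0 1 0"
        "comb 0 0 0 0 1"])
      (auto simp: rebase_simps field_simps)
qed

lemma adapted_A_2:
  assumes "adapted L 0 0 0 0 0 0 0 0 0 1"
  shows "adapted L 1 0 0 0 0 0 0 0 0 0"
proof -
  obtain v1 v2 v3 v4 v5 where "adapted_basis L v1 v2 v3 v4 v5 0 0 0 0 0 0 0 0 0 1"
    using assms(1) by (rule adaptedE)
  then interpret adapted_basis L v1 v2 v3 v4 v5 0 0 0 0 0 0 0 0 0 1 .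
  show ?thesis
    by (intro rebase[of "comb 0 0 1 0 0"
        "comb 0 0 0 1 0"
        "comb 0 0 0 0 1"
        "comb 1 0 0 0 0"
        "comb 0 1 0 0 0"])
      (auto simp: rebase_simps field_simps)
qed

lemma adapted_A_4:
  assumes "adapted L 0 0 c 0 0 0 0 0 0 1"
    and "c \<noteq> 0"
  shows "adapted L 0 0 1 0 0 0 0 0 0 1"
proof -
  obtain v1 v2 v3 v4 v5 where "adapted_basis L v1 v2 v3 v4 v5 0 0 c 0 0 0 0 0 0 1"
    using assms(1) by (rule adaptedE)
  then interpret adapted_basis L v1 v2 v3 v4 v5 0 0 c 0 0 0 0 0 0 1 .
  show ?thesis
    using assms(2-)
    by (intro rebase[of "comb (1 / c) 0 0 0 0"
        "comb 0 1 0 0 0"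
        "comb 0 0 1 0 0"
        "comb 0 0 0 1 0"
        "comb 0 0 0 0 1"])
      (auto simp: rebase_simps field_simps)
qed

text \<open>Bracketing with \<open>v3\<close> gives the chain \<open>v1\<close>,
  \<open>- d v4\<close>, \<open>- d v5\<close>, while \<open>v2\<close> splits off.\<close>

lemma adapted_A_3:
  assumes "adapted L 0 0 0 d 0 0 0 0 0 1"
    and "d \<noteq> 0"
  shows "adapted L 1 0 0 1 0 0 0 0 0 0"
proof -
  obtain v1 v2 v3 v4 v5 where "adapted_basis L v1 v2 v3 v4 v5 0 0 0 d 0 0 0 0 0 1"
    using assms(1) by (rule adaptedE)
  then interpret adapted_basis L v1 v2 v3 v4 v5 0 0 0 d 0 0 0 0 0 1 .
  show ?thesis
    using assms(2-)
    by (intro rebase[of "comb 0 0 1 0 0"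
        "comb 1 0 0 0 0"
        "comb 0 0 0 (- d) 0"
        "comb 0 0 0 0 (- d)"
        "comb 0 1 0 0 0"])
      (auto simp: rebase_simps field_simps)
qed

text \<open>The same chain, except that \<open>v2\<close> no longer splits off: scaled by
  \<open>- d / c\<close>, it brackets with \<open>v1\<close> to the end of the chain.\<close>

lemma adapted_A_5:
  assumes "adapted L 0 0 c d 0 0 0 0 0 1"
    and "d \<noteq> 0"
    and "c \<noteq> 0"
  shows "adapted L 1 0 0 0 1 0 0 0 1 0"
proof -
  obtain v1 v2 v3 v4 v5 where "adapted_basis L v1 v2 v3 v4 v5 0 0 c d 0 0 0 0 0 1"
    using assms(1) by (rule adaptedE)
  then interpret adapted_basis L v1 v2 v3 v4 v5 0 0 c d 0 0 0 0 0 1 .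
  show ?thesis
    using assms(2-)
    by (intro rebase[of "comb 0 0 1 0 0"
        "comb 1 0 0 0 0"
        "comb 0 0 0 (- d) 0"
        "comb 0 (- d / c) 0 0 0"
        "comb 0 0 0 0 (- d)"])
      (auto simp: rebase_simps field_simps)
qed

section \<open>Case (B): \<open>[v3, v4]\<close> is zero and \<open>v4\<close> is not
  central\<close>

lemma adapted_B:
  assumes "adapted L a b c d e f g h i 0"
    and "h \<noteq> 0"
  shows "adapted L a b (c / h) d (e / h) 0 ((g - i * e / h) / h) 1 0 0"
proof -
  obtain v1 v2 v3 v4 v5 where "adapted_basis L v1 v2 v3 v4 v5 a b c d e f g h i 0"
    using assms(1) by (rule adaptedE)
  then interpret adapted_basis L v1 v2 v3 v4 v5 a b c d e f g h i 0 .
  \<comment> \<open>Subtracting \<open>i / h\<close> times \<open>v1\<close> from \<open>v2\<close>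
    removes \<open>i\<close>. The Jacobi relation, now \<open>f * h = d * i\<close>, makes
    \<open>f\<close> vanish as well.\<close>
  show ?thesis
    using assms(2-) jacobi_coeffs
    by (intro rebase[of "comb 1 0 0 0 0"
        "comb (- i / h) 1 0 0 0"
        "comb 0 0 1 0 0"
        "comb 0 0 0 1 0"
        "comb 0 0 0 0 h"])
      (auto simp: rebase_simps field_simps)
qed

text \<open>The new \<open>v3\<close> is \<open>[v1, v2]\<close>; similarly
  \<open>adapted_B_ad\<close> takes \<open>[v1, v3]\<close> as the new \<open>v4\<close>.\<close>

lemma adapted_B_a:
  assumes "adapted L a b c d e 0 g 1 0 0"
    and "a \<noteq> 0"
  shows "adapted L 1 0 0 (a * d) (a * e + b) 0 (a * g) 1 0 0"
proof -
  obtain v1 v2 v3 v4 v5 where "adapted_basis L v1 v2 v3 v4 v5 a b c d e 0 g 1 0 0"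
    using assms(1) by (rule adaptedE)
  then interpret adapted_basis L v1 v2 v3 v4 v5 a b c d e 0 g 1 0 0 .
  show ?thesis
    using assms(2-)
    by (intro rebase[of "comb 1 0 0 0 0"
        "comb 0 1 0 0 0"
        "comb 0 0 a b c"
        "comb 0 0 0 1 0"
        "comb 0 0 0 0 1"])
      (auto simp: rebase_simps field_simps)
qed

lemma adapted_B_ad:
  assumes "adapted L 1 0 0 d e 0 g 1 0 0"
    and "d \<noteq> 0"
  shows "adapted L 1 0 0 1 0 0 (g / d) 1 0 0"
proof -
  obtain v1 v2 v3 v4 v5 where "adapted_basis L v1 v2 v3 v4 v5 1 0 0 d e 0 g 1 0 0"
    using assms(1) by (rule adaptedE)
  then interpret adapted_basis L v1 v2 v3 v4 v5 1 0 0 d e 0 g 1 0 0 .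
  show ?thesis
    using assms(2-)
    by (intro rebase[of "comb 1 0 0 0 0"
        "comb 0 1 0 0 0"
        "comb 0 0 1 0 0"
        "comb 0 0 0 d e"
        "comb 0 0 0 0 d"])
      (auto simp: rebase_simps field_simps)
qed

text \<open>Scaling \<open>v2, ..., v5\<close> by \<open>1 / g\<close> preserves the brackets with
  \<open>v1\<close>, but \<open>[v2, v3]\<close> is quadratic in the factor, so \<open>g\<close>
  becomes 1.\<close>

lemma adapted_B_6:
  assumes "adapted L 1 0 0 1 0 0 g 1 0 0"
    and "g \<noteq> 0"
  shows "adapted L 1 0 0 1 0 0 1 1 0 0"
proof -
  obtain v1 v2 v3 v4 v5 where "adapted_basis L v1 v2 v3 v4 v5 1 0 0 1 0 0 g 1 0 0"
    using assms(1) by (rule adaptedE)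
  then interpret adapted_basis L v1 v2 v3 v4 v5 1 0 0 1 0 0 g 1 0 0 .
  show ?thesis
    using assms(2-)
    by (intro rebase[of "comb 1 0 0 0 0"
        "comb 0 (1 / g) 0 0 0"
        "comb 0 0 (1 / g) 0 0"
        "comb 0 0 0 (1 / g) 0"
        "comb 0 0 0 0 (1 / g)"])
      (auto simp: rebase_simps field_simps)
qed

lemma adapted_B_8:
  assumes "adapted L 1 0 0 0 0 0 0 1 0 0"
  shows "adapted L 0 1 0 0 1 0 0 0 0 0"
proof -
  obtain v1 v2 v3 v4 v5 where "adapted_basis L v1 v2 v3 v4 v5 1 0 0 0 0 0 0 1 0 0"
    using assms(1) by (rule adaptedE)
  then interpret adapted_basis L v1 v2 v3 v4 v5 1 0 0 0 0 0 0 1 0 0 .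
  show ?thesis
    by (intro rebase[of "comb 1 0 0 0 0"
        "comb 0 1 0 0 0"
        "comb 0 0 0 1 0"
        "comb 0 0 1 0 0"
        "comb 0 0 0 0 1"])
      (auto simp: rebase_simps field_simps)
qed

text \<open>\<open>[v1, v3] = e v5\<close> and \<open>[v1, v4] = v5\<close>, so
  \<open>v4 - v3 / e\<close> is central and splits off.\<close>

lemma adapted_B_3:
  assumes "adapted L 1 0 0 0 e 0 0 1 0 0"
    and "e \<noteq> 0"
  shows "adapted L 1 0 0 1 0 0 0 0 0 0"
proof -
  obtain v1 v2 v3 v4 v5 where "adapted_basis L v1 v2 v3 v4 v5 1 0 0 0 e 0 0 1 0 0"
    using assms(1) by (rule adaptedE)
  then interpret adapted_basis L v1 v2 v3 v4 v5 1 0 0 0 e 0 0 1 0 0 .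
  show ?thesis
    using assms(2-)
    by (intro rebase[of "comb 1 0 0 0 0"
        "comb 0 1 0 0 0"
        "comb 0 0 1 0 0"
        "comb 0 0 0 0 e"
        "comb 0 0 (- 1 / e) 1 0"])
      (auto simp: rebase_simps field_simps)
qed

text \<open>\<open>v1 - (e / g) v2\<close> commutes with \<open>v3\<close>, so it can play the
  second basis vector, with \<open>v2\<close> as the first and \<open>- g v4\<close> as its
  partner.\<close>

lemma adapted_B_5:
  assumes "adapted L 1 0 0 0 e 0 g 1 0 0"
    and "g \<noteq> 0"
  shows "adapted L 1 0 0 0 1 0 0 0 1 0"
proof -
  obtain v1 v2 v3 v4 v5 where "adapted_basis L v1 v2 v3 v4 v5 1 0 0 0 e 0 g 1 0 0"
    using assms(1) by (rule adaptedE)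
  then interpret adapted_basis L v1 v2 v3 v4 v5 1 0 0 0 e 0 g 1 0 0 .
  show ?thesis
    using assms(2-)
    by (intro rebase[of "comb 0 1 0 0 0"
        "comb 1 (- e / g) 0 0 0"
        "comb 0 0 (- 1) 0 0"
        "comb 0 0 0 (- g) 0"
        "comb 0 0 0 0 (- g)"])
      (auto simp: rebase_simps field_simps)
qed

text \<open>As \<open>[v1, v4] = v5\<close>, multiples of \<open>v4\<close> absorb the
  \<open>v5\<close> components of \<open>[v1, v2]\<close> and \<open>[v1, v3]\<close>.\<close>

lemma adapted_B_0:
  assumes "adapted L 0 b c d e 0 g 1 0 0"
  shows "adapted L 0 b 0 d 0 0 g 1 0 0"
proof -
  obtain v1 v2 v3 v4 v5 where "adapted_basis L v1 v2 v3 v4 v5 0 b c d e 0 g 1 0 0"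
    using assms(1) by (rule adaptedE)
  then interpret adapted_basis L v1 v2 v3 v4 v5 0 b c d e 0 g 1 0 0 .
  show ?thesis
    by (intro rebase[of "comb 1 0 0 0 0"
        "comb 0 1 0 (- c) 0"
        "comb 0 0 1 (- e) 0"
        "comb 0 0 0 1 0"
        "comb 0 0 0 0 1"])
      (auto simp: rebase_simps field_simps)
qed

lemma adapted_B_0d:
  assumes "adapted L 0 b 0 d 0 0 g 1 0 0"
    and "d \<noteq> 0"
  shows "adapted L 0 0 0 d 0 0 g 1 0 0"
proof -
  obtain v1 v2 v3 v4 v5 where "adapted_basis L v1 v2 v3 v4 v5 0 b 0 d 0 0 g 1 0 0"
    using assms(1) by (rule adaptedE)
  then interpret adapted_basis L v1 v2 v3 v4 v5 0 b 0 d 0 0 g 1 0 0 .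
  show ?thesis
    using assms(2-)
    by (intro rebase[of "comb 1 0 0 0 0"
        "comb 0 1 (- b / d) 0 0"
        "comb 0 0 1 0 0"
        "comb 0 0 0 1 0"
        "comb 0 0 0 0 1"])
      (auto simp: rebase_simps field_simps)
qed

lemma adapted_B_0d_3:
  assumes "adapted L 0 0 0 d 0 0 0 1 0 0"
    and "d \<noteq> 0"
  shows "adapted L 1 0 0 1 0 0 0 0 0 0"
proof -
  obtain v1 v2 v3 v4 v5 where "adapted_basis L v1 v2 v3 v4 v5 0 0 0 d 0 0 0 1 0 0"
    using assms(1) by (rule adaptedE)
  then interpret adapted_basis L v1 v2 v3 v4 v5 0 0 0 d 0 0 0 1 0 0 .
  show ?thesis
    using assms(2-)
    by (intro rebase[of "comb 1 0 0 0 0"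
        "comb 0 0 1 0 0"
        "comb 0 0 0 d 0"
        "comb 0 0 0 0 d"
        "comb 0 1 0 0 0"])
      (auto simp: rebase_simps field_simps)
qed

text \<open>The chain under \<open>v1\<close> is \<open>v3\<close>, \<open>d v4\<close>,
  \<open>d v5\<close>, and \<open>- d / g\<close> times \<open>v2\<close> is the extra partner of
  \<open>v3\<close>. In \<open>adapted_B_0b_5\<close> the roles of \<open>v2\<close> and
  \<open>v3\<close> are exchanged.\<close>

lemma adapted_B_0d_5:
  assumes "adapted L 0 0 0 d 0 0 g 1 0 0"
    and "d \<noteq> 0"
    and "g \<noteq> 0"
  shows "adapted L 1 0 0 0 1 0 0 0 1 0"
proof -
  obtain v1 v2 v3 v4 v5 where "adapted_basis L v1 v2 v3 v4 v5 0 0 0 d 0 0 g 1 0 0"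
    using assms(1) by (rule adaptedE)
  then interpret adapted_basis L v1 v2 v3 v4 v5 0 0 0 d 0 0 g 1 0 0 .
  show ?thesis
    using assms(2-)
    by (intro rebase[of "comb 1 0 0 0 0"
        "comb 0 0 1 0 0"
        "comb 0 0 0 d 0"
        "comb 0 (- d / g) 0 0 0"
        "comb 0 0 0 0 d"])
      (auto simp: rebase_simps field_simps)
qed

lemma adapted_B_0b_5:
  assumes "adapted L 0 b 0 0 0 0 g 1 0 0"
    and "b \<noteq> 0"
    and "g \<noteq> 0"
  shows "adapted L 1 0 0 0 1 0 0 0 1 0"
proof -
  obtain v1 v2 v3 v4 v5 where "adapted_basis L v1 v2 v3 v4 v5 0 b 0 0 0 0 g 1 0 0"
    using assms(1) by (rule adaptedE)
  then interpret adapted_basis L v1 v2 v3 v4 v5 0 b 0 0 0 0 g 1 0 0 .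
  show ?thesis
    using assms(2-)
    by (intro rebase[of "comb 1 0 0 0 0"
        "comb 0 1 0 0 0"
        "comb 0 0 0 b 0"
        "comb 0 0 (b / g) 0 0"
        "comb 0 0 0 0 b"])
      (auto simp: rebase_simps field_simps)
qed

lemma adapted_B_0b_3:
  assumes "adapted L 0 b 0 0 0 0 0 1 0 0"
    and "b \<noteq> 0"
  shows "adapted L 1 0 0 1 0 0 0 0 0 0"
proof -
  obtain v1 v2 v3 v4 v5 where "adapted_basis L v1 v2 v3 v4 v5 0 b 0 0 0 0 0 1 0 0"
    using assms(1) by (rule adaptedE)
  then interpret adapted_basis L v1 v2 v3 v4 v5 0 b 0 0 0 0 0 1 0 0 .
  show ?thesis
    using assms(2-)
    by (intro rebase[of "comb 1 0 0 0 0"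
        "comb 0 1 0 0 0"
        "comb 0 0 0 b 0"
        "comb 0 0 0 0 b"
        "comb 0 0 1 0 0"])
      (auto simp: rebase_simps field_simps)
qed

lemma adapted_B_00_4:
  assumes "adapted L 0 0 0 0 0 0 g 1 0 0"
    and "g \<noteq> 0"
  shows "adapted L 0 0 1 0 0 0 0 0 0 1"
proof -
  obtain v1 v2 v3 v4 v5 where "adapted_basis L v1 v2 v3 v4 v5 0 0 0 0 0 0 g 1 0 0"
    using assms(1) by (rule adaptedE)
  then interpret adapted_basis L v1 v2 v3 v4 v5 0 0 0 0 0 0 g 1 0 0 .
  show ?thesis
    using assms(2-)
    by (intro rebase[of "comb 1 0 0 0 0"
        "comb 0 0 0 1 0"
        "comb 0 (1 / g) 0 0 0"
        "comb 0 0 1 0 0"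
        "comb 0 0 0 0 1"])
      (auto simp: rebase_simps field_simps)
qed

lemma adapted_B_00_2:
  assumes "adapted L 0 0 0 0 0 0 0 1 0 0"
  shows "adapted L 1 0 0 0 0 0 0 0 0 0"
proof -
  obtain v1 v2 v3 v4 v5 where "adapted_basis L v1 v2 v3 v4 v5 0 0 0 0 0 0 0 1 0 0"
    using assms(1) by (rule adaptedE)
  then interpret adapted_basis L v1 v2 v3 v4 v5 0 0 0 0 0 0 0 1 0 0 .
  show ?thesis
    by (intro rebase[of "comb 1 0 0 0 0"
        "comb 0 0 0 1 0"
        "comb 0 0 0 0 1"
        "comb 0 1 0 0 0"
        "comb 0 0 1 0 0"])
      (auto simp: rebase_simps field_simps)
qed

section \<open>Case (C): \<open>v4\<close> and \<open>v5\<close> are central and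
  \<open>[v1, v2]\<close> involves \<open>v3\<close>\<close>

lemma adapted_C_a:
  assumes "adapted L a b c d e f g 0 0 0"
    and "a \<noteq> 0"
  shows "adapted L 1 0 0 (a * d) (a * e) (a * f) (a * g) 0 0 0"
proof -
  obtain v1 v2 v3 v4 v5 where "adapted_basis L v1 v2 v3 v4 v5 a b c d e f g 0 0 0"
    using assms(1) by (rule adaptedE)
  then interpret adapted_basis L v1 v2 v3 v4 v5 a b c d e f g 0 0 0 .
  show ?thesis
    using assms(2-)
    by (intro rebase[of "comb 1 0 0 0 0"
        "comb 0 1 0 0 0"
        "comb 0 0 a b c"
        "comb 0 0 0 1 0"
        "comb 0 0 0 0 1"])
      (auto simp: rebase_simps field_simps)
qed

text \<open>The non-zero determinant makes \<open>[v1, v3]\<close> and \<open>[v2, v3]\<close>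
  independent, so they serve as the new \<open>v4\<close> and \<open>v5\<close>.\<close>

lemma adapted_C_9:
  assumes "adapted L 1 0 0 d e f g 0 0 0"
    and "d * g - e * f \<noteq> 0"
  shows "adapted L 1 0 0 1 0 0 1 0 0 0"
proof -
  obtain v1 v2 v3 v4 v5 where "adapted_basis L v1 v2 v3 v4 v5 1 0 0 d e f g 0 0 0"
    using assms(1) by (rule adaptedE)
  then interpret adapted_basis L v1 v2 v3 v4 v5 1 0 0 d e f g 0 0 0 .
  show ?thesis
    using assms(2-)
    by (intro rebase[of "comb 1 0 0 0 0"
        "comb 0 1 0 0 0"
        "comb 0 0 1 0 0"
        "comb 0 0 0 d e"
        "comb 0 0 0 f g"])
      (auto simp: rebase_simps field_simps dest: homogeneous_system_2x2)
qed

text \<open>Now \<open>[v2, v3]\<close> is \<open>f / d\<close> times \<open>[v1, v3]\<close>, so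
  \<open>v2 - (f / d) v1\<close> commutes with \<open>v3\<close>.\<close>

lemma adapted_C_d:
  assumes "adapted L 1 0 0 d e f g 0 0 0"
    and "d * g - e * f = 0"
    and "d \<noteq> 0"
  shows "adapted L 1 0 0 1 0 0 0 0 0 0"
proof -
  obtain v1 v2 v3 v4 v5 where "adapted_basis L v1 v2 v3 v4 v5 1 0 0 d e f g 0 0 0"
    using assms(1) by (rule adaptedE)
  then interpret adapted_basis L v1 v2 v3 v4 v5 1 0 0 d e f g 0 0 0 .
  show ?thesis
    using assms(2-)
    by (intro rebase[of "comb 1 0 0 0 0"
        "comb (- f / d) 1 0 0 0"
        "comb 0 0 1 0 0"
        "comb 0 0 0 d e"
        "comb 0 0 0 0 1"])
      (auto simp: rebase_simps field_simps)
qed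

lemma adapted_C_e:
  assumes "adapted L 1 0 0 0 e 0 g 0 0 0"
    and "e \<noteq> 0"
  shows "adapted L 1 0 0 1 0 0 0 0 0 0"
proof -
  obtain v1 v2 v3 v4 v5 where "adapted_basis L v1 v2 v3 v4 v5 1 0 0 0 e 0 g 0 0 0"
    using assms(1) by (rule adaptedE)
  then interpret adapted_basis L v1 v2 v3 v4 v5 1 0 0 0 e 0 g 0 0 0 .
  show ?thesis
    using assms(2-)
    by (intro rebase[of "comb 1 0 0 0 0"
        "comb (- g / e) 1 0 0 0"
        "comb 0 0 1 0 0"
        "comb 0 0 0 0 e"
        "comb 0 0 0 1 0"])
      (auto simp: rebase_simps field_simps)
qed

lemma adapted_C_f:
  assumes "adapted L 1 0 0 0 0 f g 0 0 0"
    and "f \<noteq> 0"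
  shows "adapted L 1 0 0 1 0 0 0 0 0 0"
proof -
  obtain v1 v2 v3 v4 v5 where "adapted_basis L v1 v2 v3 v4 v5 1 0 0 0 0 f g 0 0 0"
    using assms(1) by (rule adaptedE)
  then interpret adapted_basis L v1 v2 v3 v4 v5 1 0 0 0 0 f g 0 0 0 .
  show ?thesis
    using assms(2-)
    by (intro rebase[of "comb 0 1 0 0 0"
        "comb 1 0 0 0 0"
        "comb 0 0 (- 1) 0 0"
        "comb 0 0 0 (- f) (- g)"
        "comb 0 0 0 0 1"])
      (auto simp: rebase_simps field_simps)
qed

lemma adapted_C_g:
  assumes "adapted L 1 0 0 0 0 0 g 0 0 0"
    and "g \<noteq> 0"
  shows "adapted L 1 0 0 1 0 0 0 0 0 0"
proof -
  obtain v1 v2 v3 v4 v5 where "adapted_basis L v1 v2 v3 v4 v5 1 0 0 0 0 0 g 0 0 0"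
    using assms(1) by (rule adaptedE)
  then interpret adapted_basis L v1 v2 v3 v4 v5 1 0 0 0 0 0 g 0 0 0 .
  show ?thesis
    using assms(2-)
    by (intro rebase[of "comb 0 1 0 0 0"
        "comb 1 0 0 0 0"
        "comb 0 0 (- 1) 0 0"
        "comb 0 0 0 0 (- g)"
        "comb 0 0 0 1 0"])
      (auto simp: rebase_simps field_simps)
qed

section \<open>Case (D): the bracket sends the span of \<open>v1, v2, v3\<close> into the central
  plane of \<open>v4, v5\<close>\<close>

lemma adapted_D_swap:
  assumes "adapted L 0 b c d e f g 0 0 0"
  shows "adapted L 0 d e b c (- f) (- g) 0 0 0"
proof -
  obtain v1 v2 v3 v4 v5 where "adapted_basis L v1 v2 v3 v4 v5 0 b c d e f g 0 0 0"
    using assms(1) by (rule adaptedE)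
  then interpret adapted_basis L v1 v2 v3 v4 v5 0 b c d e f g 0 0 0 .
  \<comment> \<open>No bracket has a \<open>v3\<close> component any more, so
    \<open>v1, v2, v3\<close> may be permuted freely and \<open>v4, v5\<close> replaced by any basis
    of their plane.\<close>
  show ?thesis
    by (intro rebase[of "comb 1 0 0 0 0"
        "comb 0 0 1 0 0"
        "comb 0 1 0 0 0"
        "comb 0 0 0 1 0"
        "comb 0 0 0 0 1"])
      (auto simp: rebase_simps field_simps)
qed

lemma adapted_D_rotate:
  assumes "adapted L 0 0 0 0 0 f g 0 0 0"
  shows "adapted L 0 f g 0 0 0 0 0 0 0"
proof -
  obtain v1 v2 v3 v4 v5 where "adapted_basis L v1 v2 v3 v4 v5 0 0 0 0 0 f g 0 0 0"
    using assms(1) by (rule adaptedE)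
  then interpret adapted_basis L v1 v2 v3 v4 v5 0 0 0 0 0 f g 0 0 0 .
  show ?thesis
    by (intro rebase[of "comb 0 1 0 0 0"
        "comb 0 0 1 0 0"
        "comb 1 0 0 0 0"
        "comb 0 0 0 1 0"
        "comb 0 0 0 0 1"])
      (auto simp: rebase_simps field_simps)
qed

lemma adapted_D_b:
  assumes "adapted L 0 b c d e f g 0 0 0"
    and "b \<noteq> 0"
  shows "adapted L 0 1 0 (d / b) (e - d * c / b) (f / b) (g - f * c / b) 0 0 0"
proof -
  obtain v1 v2 v3 v4 v5 where "adapted_basis L v1 v2 v3 v4 v5 0 b c d e f g 0 0 0"
    using assms(1) by (rule adaptedE)
  then interpret adapted_basis L v1 v2 v3 v4 v5 0 b c d e f g 0 0 0 .
  show ?thesis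
    using assms(2-)
    by (intro rebase[of "comb 1 0 0 0 0"
        "comb 0 1 0 0 0"
        "comb 0 0 1 0 0"
        "comb 0 0 0 b c"
        "comb 0 0 0 0 1"])
      (auto simp: rebase_simps field_simps)
qed

lemma adapted_D_c:
  assumes "adapted L 0 0 c d e f g 0 0 0"
    and "c \<noteq> 0"
  shows "adapted L 0 1 0 (e / c) d (g / c) f 0 0 0"
proof -
  obtain v1 v2 v3 v4 v5 where "adapted_basis L v1 v2 v3 v4 v5 0 0 c d e f g 0 0 0"
    using assms(1) by (rule adaptedE)
  then interpret adapted_basis L v1 v2 v3 v4 v5 0 0 c d e f g 0 0 0 .
  show ?thesis
    using assms(2-)
    by (intro rebase[of "comb 1 0 0 0 0"
        "comb 0 1 0 0 0"
        "comb 0 0 1 0 0"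
        "comb 0 0 0 0 c"
        "comb 0 0 0 1 0"])
      (auto simp: rebase_simps field_simps)
qed

text \<open>With \<open>[v1, v2] = v4\<close>, adding \<open>f v1 - d v2\<close> to
  \<open>v3\<close> removes the \<open>v4\<close> components of its brackets with \<open>v1\<close>
  and \<open>v2\<close>.\<close>

lemma adapted_D_1:
  assumes "adapted L 0 1 0 d e f g 0 0 0"
  shows "adapted L 0 1 0 0 e 0 g 0 0 0"
proof -
  obtain v1 v2 v3 v4 v5 where "adapted_basis L v1 v2 v3 v4 v5 0 1 0 d e f g 0 0 0"
    using assms(1) by (rule adaptedE)
  then interpret adapted_basis L v1 v2 v3 v4 v5 0 1 0 d e f g 0 0 0 .
  show ?thesis
    by (intro rebase[of "comb 1 0 0 0 0"
        "comb 0 1 0 0 0"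
        "comb f (- d) 1 0 0"
        "comb 0 0 0 1 0"
        "comb 0 0 0 0 1"])
      (auto simp: rebase_simps field_simps)
qed

lemma adapted_D_2:
  assumes "adapted L 0 1 0 0 0 0 0 0 0 0"
  shows "adapted L 1 0 0 0 0 0 0 0 0 0"
proof -
  obtain v1 v2 v3 v4 v5 where "adapted_basis L v1 v2 v3 v4 v5 0 1 0 0 0 0 0 0 0 0"
    using assms(1) by (rule adaptedE)
  then interpret adapted_basis L v1 v2 v3 v4 v5 0 1 0 0 0 0 0 0 0 0 .
  show ?thesis
    by (intro rebase[of "comb 1 0 0 0 0"
        "comb 0 1 0 0 0"
        "comb 0 0 0 1 0"
        "comb 0 0 1 0 0"
        "comb 0 0 0 0 1"])
      (auto simp: rebase_simps field_simps)
qed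

lemma adapted_D_8:
  assumes "adapted L 0 1 0 0 e 0 g 0 0 0"
    and "e \<noteq> 0"
  shows "adapted L 0 1 0 0 1 0 0 0 0 0"
proof -
  obtain v1 v2 v3 v4 v5 where "adapted_basis L v1 v2 v3 v4 v5 0 1 0 0 e 0 g 0 0 0"
    using assms(1) by (rule adaptedE)
  then interpret adapted_basis L v1 v2 v3 v4 v5 0 1 0 0 e 0 g 0 0 0 .
  show ?thesis
    using assms(2-)
    by (intro rebase[of "comb 1 0 0 0 0"
        "comb (- g / e) 1 0 0 0"
        "comb 0 0 1 0 0"
        "comb 0 0 0 1 0"
        "comb 0 0 0 0 e"])
      (auto simp: rebase_simps field_simps)
qed

lemma adapted_D_8':
  assumes "adapted L 0 1 0 0 0 0 g 0 0 0"
    and "g \<noteq> 0"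
  shows "adapted L 0 1 0 0 1 0 0 0 0 0"
proof -
  obtain v1 v2 v3 v4 v5 where "adapted_basis L v1 v2 v3 v4 v5 0 1 0 0 0 0 g 0 0 0"
    using assms(1) by (rule adaptedE)
  then interpret adapted_basis L v1 v2 v3 v4 v5 0 1 0 0 0 0 g 0 0 0 .
  show ?thesis
    using assms(2-)
    by (intro rebase[of "comb 0 1 0 0 0"
        "comb (- 1) 0 0 0 0"
        "comb 0 0 1 0 0"
        "comb 0 0 0 1 0"
        "comb 0 0 0 0 g"])
      (auto simp: rebase_simps field_simps)
qed

section \<open>The classification\<close>

lemma ex_standard:
  "adapted L 0 0 0 0 0 0 0 0 0 0 \<Longrightarrow> \<exists>k. is_standard k L"
  "adapted L 1 0 0 0 0 0 0 0 0 0 \<Longrightarrow> \<exists>k. is_standard k L"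
  "adapted L 1 0 0 1 0 0 0 0 0 0 \<Longrightarrow> \<exists>k. is_standard k L"
  "adapted L 0 0 1 0 0 0 0 0 0 1 \<Longrightarrow> \<exists>k. is_standard k L"
  "adapted L 1 0 0 0 1 0 0 0 1 0 \<Longrightarrow> \<exists>k. is_standard k L"
  "adapted L 1 0 0 1 0 0 1 1 0 0 \<Longrightarrow> \<exists>k. is_standard k L"
  "adapted L 1 0 0 1 0 0 0 1 0 0 \<Longrightarrow> \<exists>k. is_standard k L"
  "adapted L 0 1 0 0 1 0 0 0 0 0 \<Longrightarrow> \<exists>k. is_standard k L"
  "adapted L 1 0 0 1 0 0 1 0 0 0 \<Longrightarrow> \<exists>k. is_standard k L"
  unfolding is_standard_def by blast+

section \<open>Case distinctions on the vanishing of constants\<close>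

lemma standard_A_1: "adapted L 0 0 c d 0 0 0 0 0 1 \<Longrightarrow> \<exists>k. is_standard k L"
  using adapted_A_2[of L] adapted_A_4[of L c] adapted_A_3[of L d] adapted_A_5[of L c d] ex_standard[of L]
  by (cases "c = 0"; cases "d = 0") auto

text \<open>A shear removes \<open>f\<close> if \<open>d \<noteq> 0\<close>; if
  \<open>d = 0\<close>, either \<open>f\<close> is zero too or the swap moves it to the place of
  \<open>d\<close>.\<close>

lemma standard_A_2: "adapted L 0 0 c d 0 f 0 0 0 1 \<Longrightarrow> \<exists>k. is_standard k L"
  using adapted_A_shear[of L c d f, THEN standard_A_1] standard_A_1[of L c d]
    adapted_swap[of L 0 0 c d 0 f 0 0 0 1] standard_A_1[of L "- c" f]
  by (cases "d = 0"; cases "f = 0") auto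

lemma standard_A: "adapted L a b c d e f g h i j \<Longrightarrow> j \<noteq> 0 \<Longrightarrow> \<exists>k. is_standard k L"
  by (rule standard_A_2[OF adapted_A])

lemma standard_B_1:
  assumes "adapted L 1 0 0 d e 0 g 1 0 0"
  shows "\<exists>k. is_standard k L"
proof (cases "d = 0")
  case True
  then show ?thesis
    using assms adapted_B_8[of L] adapted_B_3[of L e] adapted_B_5[of L e g] ex_standard[of L]
    by (cases "g = 0"; cases "e = 0") auto
next
  case False
  then show ?thesis
    using adapted_B_ad[OF assms] adapted_B_6[of L "g / d"] ex_standard[of L]
    by (cases "g = 0") auto
qed

lemma standard_B_2:
  assumes "adapted L 0 b 0 d 0 0 g 1 0 0"
  shows "\<exists>k. is_standard k L"
proof (cases "d = 0")
  case True
  then show ?thesis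
    using assms adapted_B_0b_5[of L b g] adapted_B_0b_3[of L b] adapted_B_00_4[of L g]
      adapted_B_00_2[of L] ex_standard[of L]
    by (cases "b = 0"; cases "g = 0") auto
next
  case False
  then show ?thesis
    using adapted_B_0d[OF assms] adapted_B_0d_3[of L d] adapted_B_0d_5[of L d g] ex_standard[of L]
    by (cases "g = 0") auto
qed

lemma standard_B_3: "adapted L a b c d e 0 g 1 0 0 \<Longrightarrow> \<exists>k. is_standard k L"
  using adapted_B_a[of L a b c d e g, THEN standard_B_1] adapted_B_0[of L b c d e g, THEN standard_B_2]
  by (cases "a = 0") auto

lemma standard_B: "adapted L a b c d e f g h i 0 \<Longrightarrow> h \<noteq> 0 \<Longrightarrow> \<exists>k. is_standard k L"
  by (rule standard_B_3[OF adapted_B])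

lemma standard_C_1:
  assumes "adapted L 1 0 0 d e f g 0 0 0"
  shows "\<exists>k. is_standard k L"
proof -
  \<comment> \<open>When \<open>d = 0\<close> the determinant is \<open>- e * f\<close>, so it is
    non-zero or one of \<open>e\<close>, \<open>f\<close> vanishes.\<close>
  consider "d * g - e * f \<noteq> 0" | "d * g - e * f = 0" "d \<noteq> 0"
    | "d = 0" "f = 0" "e \<noteq> 0" | "d = 0" "e = 0" "f \<noteq> 0" | "d = 0" "e = 0" "f = 0" "g \<noteq> 0"
    | "d = 0" "e = 0" "f = 0" "g = 0"
    by (cases "d = 0"; cases "e = 0"; cases "f = 0") auto
  then show ?thesis
  proof cases
    case 1
    with assms have "adapted L 1 0 0 1 0 0 1 0 0 0" by (rule adapted_C_9)
    then show ?thesis by (rule ex_standard)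
  next
    case 2
    with assms have "adapted L 1 0 0 1 0 0 0 0 0 0" by (rule adapted_C_d)
    then show ?thesis by (rule ex_standard)
  next
    case 3
    with assms have "adapted L 1 0 0 0 e 0 g 0 0 0" by simp
    then have "adapted L 1 0 0 1 0 0 0 0 0 0" using 3(3) by (rule adapted_C_e)
    then show ?thesis by (rule ex_standard)
  next
    case 4
    with assms have "adapted L 1 0 0 0 0 f g 0 0 0" by simp
    then have "adapted L 1 0 0 1 0 0 0 0 0 0" using 4(3) by (rule adapted_C_f)
    then show ?thesis by (rule ex_standard)
  next
    case 5
    with assms have "adapted L 1 0 0 0 0 0 g 0 0 0" by simp
    then have "adapted L 1 0 0 1 0 0 0 0 0 0" using 5(4) by (rule adapted_C_g)
    then show ?thesis by (rule ex_standard)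
  next
    case 6
    with assms have "adapted L 1 0 0 0 0 0 0 0 0 0" by simp
    then show ?thesis by (rule ex_standard)
  qed
qed

lemma standard_D_1:
  assumes "adapted L 0 1 0 d e f g 0 0 0"
  shows "\<exists>k. is_standard k L"
  using adapted_D_1[OF assms] adapted_D_2[of L] adapted_D_8[of L e g] adapted_D_8'[of L g] ex_standard[of L]
  by (cases "e = 0"; cases "g = 0") auto

lemma standard_D_2:
  assumes "adapted L 0 b c d e f g 0 0 0" "b \<noteq> 0 \<or> c \<noteq> 0"
  shows "\<exists>k. is_standard k L"
  using assms adapted_D_b[of L b c d e f g, THEN standard_D_1] adapted_D_c[of L c d e f g, THEN standard_D_1]
  by (cases "b = 0") auto

text \<open>If \<open>a = 0\<close>, a permutation of \<open>v1, v2, v3\<close> makes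
  \<open>[v1, v2]\<close> non-zero unless the algebra is abelian.\<close>

lemma standard_C:
  assumes "adapted L a b c d e f g 0 0 0"
  shows "\<exists>k. is_standard k L"
proof (cases "a = 0")
  case True
  then have L: "adapted L 0 b c d e f g 0 0 0" using assms by simp
  consider "b \<noteq> 0 \<or> c \<noteq> 0" | "d \<noteq> 0 \<or> e \<noteq> 0" | "b = 0" "c = 0" "d = 0" "e = 0" "f \<noteq> 0 \<or> g \<noteq> 0"
    | "b = 0" "c = 0" "d = 0" "e = 0" "f = 0" "g = 0"
    by blast
  then show ?thesis
  proof cases
    case 1
    then show ?thesis by (rule standard_D_2[OF L])
  next
    case 2
    then show ?thesis by (rule standard_D_2[OF adapted_D_swap[OF L]])
  next
    case 3
    then have "adapted L 0 0 0 0 0 f g 0 0 0" using L by simp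
    then show ?thesis using 3(5) by (rule standard_D_2[OF adapted_D_rotate])
  next
    case 4
    then have "adapted L 0 0 0 0 0 0 0 0 0 0" using L by simp
    then show ?thesis by (rule ex_standard)
  qed
next
  case False
  then show ?thesis using standard_C_1[OF adapted_C_a[OF assms]] by blast
qed

lemma standard_classification:
  assumes "adapted L a b c d e f g h i j"
  shows "\<exists>k. is_standard k L"
proof -
  consider "j \<noteq> 0" | "j = 0" "h \<noteq> 0" | "j = 0" "i \<noteq> 0" | "j = 0" "h = 0" "i = 0"
    by blast
  then show ?thesis
  proof cases
    case 1
    then show ?thesis by (rule standard_A[OF assms])
  next
    case 2
    then have "adapted L a b c d e f g h i 0" using assms by simp
    then show ?thesis using 2(2) by (rule standard_B)
  next
    case 3
    then have "adapted L (- a) (- b) (- c) f g d e i h 0" using adapted_swap[OF assms] by simp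
    then show ?thesis using 3(2) by (rule standard_B)
  next
    case 4
    then have "adapted L a b c d e f g 0 0 0" using assms by simp
    then show ?thesis by (rule standard_C)
  qed
qed

section \<open>From structure constants back to isomorphism\<close>

lemma lie_iso_iff_adapted:
  assumes "lie_algebra L" "adapted M a b c d e f g h i j"
  shows "L \<cong>\<^sub>L M \<longleftrightarrow> adapted L a b c d e f g h i j"
proof
  show "L \<cong>\<^sub>L M \<Longrightarrow> adapted L a b c d e f g h i j"
    using adapted_lie_iso assms by blast
  show "L \<cong>\<^sub>L M" if "adapted L a b c d e f g h i j"
    using that assms(2) by (elim adaptedE) (rule adapted_basis_imp_lie_iso)
qed

lemma iso_L5_iff_is_standard: "lie_algebra L \<Longrightarrow> iso_L5 k L \<longleftrightarrow> is_standard k L"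
  by (simp only: iso_L5_def is_standard_def lie_iso_iff_adapted[OF _ adapted_L5_1]
    lie_iso_iff_adapted[OF _ adapted_L5_2]
    lie_iso_iff_adapted[OF _ adapted_L5_3]
    lie_iso_iff_adapted[OF _ adapted_L5_4]
    lie_iso_iff_adapted[OF _ adapted_L5_5]
    lie_iso_iff_adapted[OF _ adapted_L5_6]
    lie_iso_iff_adapted[OF _ adapted_L5_7]
    lie_iso_iff_adapted[OF _ adapted_L5_8]
    lie_iso_iff_adapted[OF _ adapted_L5_9])

lemma adapted_imp_nilpotent_of_dim_5: "adapted L a b c d e f g h i j \<Longrightarrow> nilpotent_of_dim 5 L"
  using adapted_basis.nilpotent_of_dim_5 unfolding adapted_def by blast

lemma nilpotent_of_dim_5_ex1_iso_L5:
  assumes "nilpotent_of_dim 5 L"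
  shows "\<exists>!k. iso_L5 k L"
proof -
  interpret nilpotent_lie_algebra L using assms by (simp add: nilpotent_of_dim_def)
  have "dim UNIV = 5" using assms by (simp add: nilpotent_of_dim_def lie_dim_def)
  then obtain v1 v2 v3 v4 v5 a b c d e f g h i j
    where "adapted_basis L v1 v2 v3 v4 v5 a b c d e f g h i j"
    using ex_adapted_basis by blast
  then have "\<exists>k. is_standard k L" by (intro standard_classification adaptedI)
  then show ?thesis
    unfolding iso_L5_iff_is_standard[OF lie_algebra_axioms] using standard_index by blast
qed

text \<open>Applied to the nine algebras themselves, this gives their pairwise
  non-isomorphism.\<close>

lemma iso_L5_iff_index:
  assumes "is_standard k L"
  shows "iso_L5 k' L \<longleftrightarrow> k' = k"
proof -
  have "lie_algebra L"
    using assms unfolding is_standard_def adapted_def adapted_basis_def by blast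
  then show ?thesis
    using iso_L5_iff_is_standard standard_index assms by metis
qed

section \<open>The CB condition\<close>

lemma adapted_imp_cb_algebra:
  assumes "adapted L a b c d e f g 0 0 j"
    and "a = 0 \<or> d = 0 \<and> e = 0 \<and> f = 0 \<and> g = 0 \<and> j = 0" "j = 0 \<or> b = 0 \<and> d = 0 \<and> f = 0"
  shows "cb_algebra L"
proof -
  obtain v1 v2 v3 v4 v5 where "adapted_basis L v1 v2 v3 v4 v5 a b c d e f g 0 0 j"
    using assms(1) by (rule adaptedE)
  then interpret adapted_basis L v1 v2 v3 v4 v5 a b c d e f g 0 0 j .
  show ?thesis
  proof
    fix x y z
    obtain x1 x2 x3 x4 x5 where x: "x = comb x1 x2 x3 x4 x5" using ex_comb by blast
    obtain y1 y2 y3 y4 y5 where y: "y = comb y1 y2 y3 y4 y5" using ex_comb by blast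
    obtain z1 z2 z3 z4 z5 where z: "z = comb z1 z2 z3 z4 z5" using ex_comb by blast
    \<comment> \<open>The conditions on the constants put all products into the center, so every
      triple product vanishes.\<close>
    show "brack L (brack L x z) y = 0"
      unfolding x y z using assms(2,3) by (auto simp: brack_comb comb_eq_0_iff)
  qed
qed

text \<open>The CB condition fails for \<open>x = y = v1\<close> and \<open>z = v2\<close>: the
  product \<open>[[v1, v2], v1]\<close> has coefficients \<open>- a * d\<close> along
  \<open>v4\<close> and, as \<open>b * h = 0\<close>, \<open>- a * e\<close> along
  \<open>v5\<close>.\<close>

lemma adapted_imp_not_cb_algebra:
  assumes "adapted L a b c d e f g h i j" "a * d \<noteq> 0 \<or> a * e \<noteq> 0" "b * h = 0"
  shows "\<not> cb_algebra L"
proof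
  assume "cb_algebra L"
  then interpret C: cb_algebra L .
  obtain v1 v2 v3 v4 v5 where "adapted_basis L v1 v2 v3 v4 v5 a b c d e f g h i j"
    using assms(1) by (rule adaptedE)
  then interpret adapted_basis L v1 v2 v3 v4 v5 a b c d e f g h i j .
  have "brack L (brack L (comb 1 0 0 0 0) (comb 0 1 0 0 0)) (comb 1 0 0 0 0) = 0"
    by (rule C.cb) (rule C.brack_self)
  then show False using assms(2,3) by (auto simp: brack_comb comb_eq_0_iff mult.commute)
qed

theorem proposition5p3:
  assumes char: "CHAR('f::field) \<noteq> 2"
  shows
    "(\<forall>L :: ('f, 'v::ab_group_add) lie_struct. nilpotent_of_dim 5 L \<longrightarrow> (\<exists>!k. iso_L5 k L)) \<and>
     (nilpotent_of_dim 5 (L5_1 :: ('f, (('f ^ 3) \<times> 'f) \<times> 'f) lie_struct)) \<and>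
     (nilpotent_of_dim 5 (L5_2 :: ('f, (('f ^ 3) \<times> 'f) \<times> 'f) lie_struct)) \<and>
     (nilpotent_of_dim 5 (L5_3 :: ('f, ('f ^ 4) \<times> 'f) lie_struct)) \<and>
     (nilpotent_of_dim 5 (L5_4 :: ('f, 'f ^ 5) lie_struct)) \<and>
     (nilpotent_of_dim 5 (L5_5 :: ('f, 'f ^ 5) lie_struct)) \<and>
     (nilpotent_of_dim 5 (L5_6 :: ('f, 'f ^ 5) lie_struct)) \<and>
     (nilpotent_of_dim 5 (L5_7 :: ('f, 'f ^ 5) lie_struct)) \<and>
     (nilpotent_of_dim 5 (L5_8 :: ('f, 'f ^ 5) lie_struct)) \<and>
     (nilpotent_of_dim 5 (L5_9 :: ('f, 'f ^ 5) lie_struct)) \<and>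
     (\<forall>k. iso_L5 k (L5_1 :: ('f, (('f ^ 3) \<times> 'f) \<times> 'f) lie_struct) \<longleftrightarrow> k = 1) \<and>
     (\<forall>k. iso_L5 k (L5_2 :: ('f, (('f ^ 3) \<times> 'f) \<times> 'f) lie_struct) \<longleftrightarrow> k = 2) \<and>
     (\<forall>k. iso_L5 k (L5_3 :: ('f, ('f ^ 4) \<times> 'f) lie_struct) \<longleftrightarrow> k = 3) \<and>
     (\<forall>k. iso_L5 k (L5_4 :: ('f, 'f ^ 5) lie_struct) \<longleftrightarrow> k = 4) \<and>
     (\<forall>k. iso_L5 k (L5_5 :: ('f, 'f ^ 5) lie_struct) \<longleftrightarrow> k = 5) \<and>
     (\<forall>k. iso_L5 k (L5_6 :: ('f, 'f ^ 5) lie_struct) \<longleftrightarrow> k = 6) \<and>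
     (\<forall>k. iso_L5 k (L5_7 :: ('f, 'f ^ 5) lie_struct) \<longleftrightarrow> k = 7) \<and>
     (\<forall>k. iso_L5 k (L5_8 :: ('f, 'f ^ 5) lie_struct) \<longleftrightarrow> k = 8) \<and>
     (\<forall>k. iso_L5 k (L5_9 :: ('f, 'f ^ 5) lie_struct) \<longleftrightarrow> k = 9) \<and>
     (cb_algebra (L5_1 :: ('f, (('f ^ 3) \<times> 'f) \<times> 'f) lie_struct)) \<and>
     (cb_algebra (L5_2 :: ('f, (('f ^ 3) \<times> 'f) \<times> 'f) lie_struct)) \<and>
     (cb_algebra (L5_4 :: ('f, 'f ^ 5) lie_struct)) \<and>
     (cb_algebra (L5_8 :: ('f, 'f ^ 5) lie_struct)) \<and>
     (\<not> cb_algebra (L5_3 :: ('f, ('f ^ 4) \<times> 'f) lie_struct)) \<and>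
     (\<not> cb_algebra (L5_5 :: ('f, 'f ^ 5) lie_struct)) \<and>
     (\<not> cb_algebra (L5_6 :: ('f, 'f ^ 5) lie_struct)) \<and>
     (\<not> cb_algebra (L5_7 :: ('f, 'f ^ 5) lie_struct)) \<and>
     (\<not> cb_algebra (L5_9 :: ('f, 'f ^ 5) lie_struct))"
  by (intro conjI allI impI nilpotent_of_dim_5_ex1_iso_L5)
    (assumption
    | rule adapted_imp_nilpotent_of_dim_5[OF adapted_L5_1]
      adapted_imp_nilpotent_of_dim_5[OF adapted_L5_2]
      adapted_imp_nilpotent_of_dim_5[OF adapted_L5_3]
      adapted_imp_nilpotent_of_dim_5[OF adapted_L5_4]
      adapted_imp_nilpotent_of_dim_5[OF adapted_L5_5]
      adapted_imp_nilpotent_of_dim_5[OF adapted_L5_6]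
      adapted_imp_nilpotent_of_dim_5[OF adapted_L5_7]
      adapted_imp_nilpotent_of_dim_5[OF adapted_L5_8]
      adapted_imp_nilpotent_of_dim_5[OF adapted_L5_9]
    | rule iso_L5_iff_index, simp add: is_standard_def adapted_L5_1
      adapted_L5_2
      adapted_L5_3
      adapted_L5_4
      adapted_L5_5
      adapted_L5_6
      adapted_L5_7
      adapted_L5_8
      adapted_L5_9
    | rule adapted_imp_cb_algebra[OF adapted_L5_1]
      adapted_imp_cb_algebra[OF adapted_L5_2]
      adapted_imp_cb_algebra[OF adapted_L5_4]
      adapted_imp_cb_algebra[OF adapted_L5_8], simp, simp
    | rule adapted_imp_not_cb_algebra[OF adapted_L5_3]
      adapted_imp_not_cb_algebra[OF adapted_L5_5]
      adapted_imp_not_cb_algebra[OF adapted_L5_6]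
      adapted_imp_not_cb_algebra[OF adapted_L5_7]
      adapted_imp_not_cb_algebra[OF adapted_L5_9], simp, simp)+

end
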